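(* Let $p\in[0,\infty]$ and let $R\equiv K_Rh^p$ be constant in time, with $K_R>0$ independent of $h$ (and $K_Rh^\infty:=0$). Consider the covariance recursion and gains of the Gaussian ODE filter with $q=1$ and integrated Brownian motion prior with step size $h>0$ (defined in the context); in each coordinate, with scale $\sigma>0$, write $S:=\sqrt{4\sigma^2Rh+\sigma^4h^2}$. Then the following limits exist and are the unique (attractive) steady states of the respective quantities: $$P_{11}^{-,\infty}:=\lim_{n\to\infty}P_{11}^-(nh)=\tfrac12\left(\sigma^2h+S\right),$$ $$P_{11}^{\infty}:=\lim_{n\to\infty}P_{11}(nh)=\frac{(\sigma^2h+S)R}{\sigma^2h+S+2R},$$ $$P_{01}^{-,\infty}:=\lim_{n\to\infty}P_{01}^-(nh)=\frac{\sigma^4h^2+(2R+\sigma^2h)S+4R\sigma^2h}{2(\sigma^2h+S)}\,h,$$ $$P_{01}^{\infty}:=\lim_{n\to\infty}P_{01}(nh)=\frac{R\,S}{\sigma^2h+S}\,h,$$ $$\beta^{\infty,(0)}:=\lim_{n\to\infty}\beta^{(0)}(nh)=\frac{S}{\sigma^2h+S}\,h,\qquad \beta^{\infty,(1)}:=\lim_{n\to\infty}\beta^{(1)}(nh)=\frac{\sigma^2h+S}{\sigma^2h+S+2R}.$$ If furthermore $T>0$ is fixed, $T/h\in\mathbb N$, and the initial covariance satisfies $\|P(0)_{k,l}\|\le K_0h^{3-k-l}$ for all $k,l\in\{0,1\}$ with a constant $K_0>0$ independent of $h$, then there is a constant $K>0$ independent of $h$ such that for all sufficiently small $h>0$, with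 all maxima over $n\in\{1,\dots,T/h\}$, $$\max_nP_{11}^-(nh)\le Kh^{1\wedge\frac{p+1}2},\qquad \max_nP_{11}(nh)\le Kh^{p\vee\frac{p+1}2},\qquad \max_n\|P_{01}(nh)\|\le Kh^{p+1},$$ $$\max_n\left\|\beta^{(0)}(nh)\right\|\le Kh,\qquad \max_n\left\|1-\beta^{(1)}(nh)\right\|\le Kh^{(p-1)\vee0}.$$ All of these bounds are sharp in the sense that they fail for any higher order in the exponent of $h$.
   Context: Indices start at $0$; $a\wedge b=\min(a,b)$, $a\vee b=\max(a,b)$, and $h^\infty:=0$. Let $d\in\mathbb N$. For each coordinate $j\in\{0,\dots,d-1\}$ fix $\sigma_j>0$ and put $$A(h)=\begin{pmatrix}1&h\\ 0&1\end{pmatrix},\qquad Q_j(h)=\sigma_j^2\begin{pmatrix}h^3/3&h^2/2\\ h^2/2&h\end{pmatrix}.$$ Starting from symmetric positive semidefinite $P_j(0)\in\mathbb R^{2\times2}$ (which may depend on $h$), define for $n=0,1,2,\dots$ $$P_j^-((n+1)h)=A(h)P_j(nh)A(h)^\intercal+Q_j(h),$$ $$\beta_j^{(i)}((n+1)h)=\frac{P_j^-((n+1)h)_{i1}}{P_j^-((n+1)h)_{11}+R}\quad(i=0,1),$$ $$P_j((n+1)h)=P_j^-((n+1)h)-\frac{P_j^-((n+1)h)_{:,1}\,P_j^-((n+1)h)_{1,:}}{P_j^-((n+1)h)_{11}+R}.$$ In the claim, $P_{kl}$, $P^-_{kl}$, $\beta^{(i)}$ denote the vectors in $\mathbb R^d$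 with components $(P_j)_{kl}$, $(P_j^-)_{kl}$, $\beta_j^{(i)}$; the formulas and inequalities without norm are meant in each coordinate $j$ separately (with $\sigma=\sigma_j$), $\|\cdot\|$ is a fixed norm on $\mathbb R^d$, and the $1$ in $1-\beta^{(1)}$ is the all-ones vector. The limits $n\to\infty$ are for fixed $h$, along the recursion continued for all $n$. "Steady state" means a fixed point of the recursion; "attractive" means that it is the limit from every initial covariance. *)

theory Defs
  imports "HOL-Analysis.Analysis"
begin

text \<open>
  The type \<open>2\<close> has the elements \<open>0\<close> and \<open>1\<close> (with \<open>2 = 0\<close>), so \<open>P $ k $ l\<close> for
  \<open>P :: real ^ 2 ^ 2\<close> is the zero-based entry \<open>P\<^sub>k\<^sub>l\<close>. The library function \<open>vector\<close> numbers from
  \<open>1\<close> and would therefore swap rows and columns; hence \<open>mat22\<close>.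
\<close>

definition mat22 :: "real \<Rightarrow> real \<Rightarrow> real \<Rightarrow> real \<Rightarrow> real ^ 2 ^ 2" where
  "mat22 a b c d =
     (\<chi> k l. if k = 0 then (if l = 0 then a else b) else (if l = 0 then c else d))"

definition is_cov :: "real ^ 2 ^ 2 \<Rightarrow> bool" where
  "is_cov P \<longleftrightarrow> transpose P = P \<and> (\<forall>x. 0 \<le> x \<bullet> (P *v x))"

definition is_norm :: "('a :: real_vector \<Rightarrow> real) \<Rightarrow> bool" where
  "is_norm f \<longleftrightarrow> (\<forall>x. 0 \<le> f x) \<and> (\<forall>x. f x = 0 \<longleftrightarrow> x = 0) \<and>
     (\<forall>c x. f (c *\<^sub>R x) = \<bar>c\<bar> * f x) \<and> (\<forall>x y. f (x + y) \<le> f x + f y)"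


subsection \<open>The covariance recursion of one coordinate\<close>

definition trans_mat :: "real \<Rightarrow> real ^ 2 ^ 2" where
  "trans_mat h = mat22 1 h 0 1"

definition noise_mat :: "real \<Rightarrow> real \<Rightarrow> real ^ 2 ^ 2" where
  "noise_mat \<sigma> h = \<sigma>\<^sup>2 *\<^sub>R mat22 (h ^ 3 / 3) (h\<^sup>2 / 2) (h\<^sup>2 / 2) h"

definition predict :: "real \<Rightarrow> real \<Rightarrow> real ^ 2 ^ 2 \<Rightarrow> real ^ 2 ^ 2" where
  "predict h \<sigma> P = trans_mat h ** P ** transpose (trans_mat h) + noise_mat \<sigma> h"

definition gain :: "real \<Rightarrow> 2 \<Rightarrow> real ^ 2 ^ 2 \<Rightarrow> real" where
  "gain R i Pm = Pm $ i $ 1 / (Pm $ 1 $ 1 + R)"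

definition update :: "real \<Rightarrow> real ^ 2 ^ 2 \<Rightarrow> real ^ 2 ^ 2" where
  "update R Pm = Pm - (\<chi> k l. Pm $ k $ 1 * Pm $ 1 $ l / (Pm $ 1 $ 1 + R))"

definition cov_step :: "real \<Rightarrow> real \<Rightarrow> real \<Rightarrow> real ^ 2 ^ 2 \<Rightarrow> real ^ 2 ^ 2" where
  "cov_step h \<sigma> R P = update R (predict h \<sigma> P)"

definition pred_step :: "real \<Rightarrow> real \<Rightarrow> real \<Rightarrow> real ^ 2 ^ 2 \<Rightarrow> real ^ 2 ^ 2" where
  "pred_step h \<sigma> R Pm = predict h \<sigma> (update R Pm)"

primrec cov :: "real \<Rightarrow> real \<Rightarrow> real \<Rightarrow> real ^ 2 ^ 2 \<Rightarrow> nat \<Rightarrow> real ^ 2 ^ 2" where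
  "cov h \<sigma> R P0 0 = P0"
| "cov h \<sigma> R P0 (Suc n) = cov_step h \<sigma> R (cov h \<sigma> R P0 n)"

text \<open>Predictions, and hence gains, are meaningful from \<open>n = 1\<close> on; the value at \<open>n = 0\<close> is junk.\<close>

definition pred_cov :: "real \<Rightarrow> real \<Rightarrow> real \<Rightarrow> real ^ 2 ^ 2 \<Rightarrow> nat \<Rightarrow> real ^ 2 ^ 2" where
  "pred_cov h \<sigma> R P0 n = predict h \<sigma> (cov h \<sigma> R P0 (n - 1))"


subsection \<open>Steady states\<close>

text \<open>
  The full recursion need not have a fixed point (for \<open>R = 0\<close>, \<open>P\<^sub>0\<^sub>0\<close> tends to infinity), but the entry
  \<open>P\<^sub>1\<^sub>1\<close> evolves autonomously, and so does the pair \<open>P\<^sub>0\<^sub>1, P\<^sub>1\<^sub>1\<close>. Below, \<open>I = {1}\<close> or \<open>I = UNIV\<close>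
  selects the entries \<open>P\<^sub>i\<^sub>1\<close> on which the quantity \<open>q\<close> depends; a steady state of \<open>q\<close> is its value at a
  fixed point of the recursion \<open>F\<close> for these entries.
\<close>

definition steady_state ::
    "(real ^ 2 ^ 2 \<Rightarrow> real ^ 2 ^ 2) \<Rightarrow> 2 set \<Rightarrow> (real ^ 2 ^ 2 \<Rightarrow> real) \<Rightarrow> real \<Rightarrow> bool" where
  "steady_state F I q v \<longleftrightarrow> (\<exists>P. is_cov P \<and> (\<forall>i\<in>I. F P $ i $ 1 = P $ i $ 1) \<and> q P = v)"

text \<open>\<open>C P0\<close> is the sequence of covariances generated from the initial covariance \<open>P0\<close>.\<close>

definition unique_attractive_steady_state ::
    "(real ^ 2 ^ 2 \<Rightarrow> nat \<Rightarrow> real ^ 2 ^ 2) \<Rightarrow> (real ^ 2 ^ 2 \<Rightarrow> real ^ 2 ^ 2) \<Rightarrow> 2 set \<Rightarrow>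
     (real ^ 2 ^ 2 \<Rightarrow> real) \<Rightarrow> real \<Rightarrow> bool" where
  "unique_attractive_steady_state C F I q L \<longleftrightarrow>
     (\<forall>P0. is_cov P0 \<longrightarrow> (\<lambda>n. q (C P0 n)) \<longlonglongrightarrow> L) \<and> (\<forall>v. steady_state F I q v \<longleftrightarrow> v = L)"


subsection \<open>All coordinates\<close>

definition cov_vec ::
    "real \<Rightarrow> ('d \<Rightarrow> real) \<Rightarrow> real \<Rightarrow> ('d \<Rightarrow> real ^ 2 ^ 2) \<Rightarrow> nat \<Rightarrow> 2 \<Rightarrow> 2 \<Rightarrow> real ^ 'd::finite" where
  "cov_vec h \<sigma> R P0 n k l = (\<chi> j. cov h (\<sigma> j) R (P0 j) n $ k $ l)"

definition pred_cov_vec ::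
    "real \<Rightarrow> ('d \<Rightarrow> real) \<Rightarrow> real \<Rightarrow> ('d \<Rightarrow> real ^ 2 ^ 2) \<Rightarrow> nat \<Rightarrow> 2 \<Rightarrow> 2 \<Rightarrow> real ^ 'd::finite" where
  "pred_cov_vec h \<sigma> R P0 n k l = (\<chi> j. pred_cov h (\<sigma> j) R (P0 j) n $ k $ l)"

definition gain_vec ::
    "real \<Rightarrow> ('d \<Rightarrow> real) \<Rightarrow> real \<Rightarrow> ('d \<Rightarrow> real ^ 2 ^ 2) \<Rightarrow> nat \<Rightarrow> 2 \<Rightarrow> real ^ 'd::finite" where
  "gain_vec h \<sigma> R P0 n i = (\<chi> j. gain R i (pred_cov h (\<sigma> j) R (P0 j) n))"


subsection \<open>Orders in the step size\<close>

text \<open>\<open>hpow h p = h\<^sup>p\<close> for \<open>p \<in> [0,\<infinity>]\<close> with the convention \<open>h\<^sup>\<infinity> = 0\<close>.\<close>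

definition hpow :: "real \<Rightarrow> ereal \<Rightarrow> real" where
  "hpow h p = (if p = \<infinity> then 0 else h powr real_of_ereal p)"

text \<open>Sufficiently small \<open>h > 0\<close> for which \<open>T / h\<close> is a natural number.\<close>

definition small_steps :: "real \<Rightarrow> real filter" where
  "small_steps T = at 0 within {h. 0 < h \<and> T / h \<in> \<nat>}"

definition max_steps :: "real \<Rightarrow> real \<Rightarrow> (nat \<Rightarrow> real) \<Rightarrow> real" where
  "max_steps T h f = (MAX n\<in>{1..nat \<lfloor>T / h\<rfloor>}. f n)"

end

theory Submission
  imports Defs
begin

text \<open>
  The predicted entry \<open>x\<^sub>n = P\<^sup>-\<^sub>1\<^sub>1((n + 1)h)\<close> follows the scalar Riccati recursion
  \<open>x \<mapsto> x r / (x + r) + \<sigma>\<^sup>2 h\<close>, a contraction whose fixed point \<open>X\<close> solves \<open>X\<^sup>2 = \<sigma>\<^sup>2 h (X + r)\<close>;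
  given \<open>x\<close>, the entry \<open>y\<^sub>n = P\<^sup>-\<^sub>0\<^sub>1((n + 1)h)\<close> follows a linear recursion with contraction factors
  \<open>r / (x\<^sub>n + r)\<close>. For the orders, \<open>x\<^sub>n \<le> x\<^sub>0 + \<sigma>\<^sup>2 h + sqrt (\<sigma>\<^sup>2 h r)\<close> and \<open>\<bar>y\<^sub>n\<bar> \<le> K h (x\<^sub>n + r)\<close> are
  invariant. Sharpness cannot be read off the steady states, since \<open>n \<le> T / h\<close>: instead, \<open>x\<close> gains at
  least \<open>\<sigma>\<^sup>2 h / 2\<close> per step until it has order \<open>sqrt (h r)\<close>, and \<open>y - \<kappa> h (x + r)\<close> gains at least
  \<open>\<sigma>\<^sup>2 h\<^sup>2 / 4\<close> per step while it is nonpositive, so it becomes positive before time \<open>T\<close>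
  once \<open>\<kappa>\<close> is small.
\<close>

section \<open>Second-column entries of the recursion, and steady states from fixed-point
  equations\<close>

lemma UNIV_2_zero_one: "(UNIV :: 2 set) = {0, 1}"
  by (auto simp: UNIV_2)

lemma predict_1_1: "predict h \<sigma> P $ 1 $ 1 = P $ 1 $ 1 + \<sigma>\<^sup>2 * h"
  by (simp add: predict_def trans_mat_def noise_mat_def mat22_def matrix_matrix_mult_def
      transpose_def UNIV_2_zero_one)

lemma predict_0_1: "predict h \<sigma> P $ 0 $ 1 = P $ 0 $ 1 + h * P $ 1 $ 1 + \<sigma>\<^sup>2 * h\<^sup>2 / 2"
  by (simp add: predict_def trans_mat_def noise_mat_def mat22_def matrix_matrix_mult_def
      transpose_def UNIV_2_zero_one algebra_simps)

lemma update_1: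
  assumes "P $ 1 $ 1 + r \<noteq> 0"
  shows "update r P $ i $ 1 = P $ i $ 1 * r / (P $ 1 $ 1 + r)"
  using assms by (simp add: update_def field_simps)

lemma is_cov_1_1_nonneg:
  assumes "is_cov P"
  shows "0 \<le> P $ 1 $ 1"
proof -
  have "axis 1 1 \<bullet> (P *v axis 1 1) = P $ 1 $ 1"
    by (simp add: inner_axis' matrix_vector_mult_basis column_def)
  then show ?thesis using assms by (metis is_cov_def)
qed

text \<open>The quadratic form is the square \<open>(b * x $ 0 + a * x $ 1)\<^sup>2 / a\<close>; for
  \<open>a = 0\<close> the matrix is zero, as then \<open>b = 0\<close> and
  \<open>b\<^sup>2 / a = 0\<close>. This supplies the covariance that \<open>steady_state\<close>
  asks for when only the second column is prescribed.\<close>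

lemma is_cov_mat22:
  assumes "0 \<le> a" "a = 0 \<Longrightarrow> b = 0"
  shows "is_cov (mat22 (b\<^sup>2 / a) b b a)"
proof -
  have "0 \<le> x \<bullet> (mat22 (b\<^sup>2 / a) b b a *v x)" for x :: "real ^ 2"
  proof (cases "a = 0")
    case True
    then show ?thesis using assms
      by (simp add: mat22_def inner_vec_def matrix_vector_mult_def UNIV_2_zero_one)
  next
    case False
    then have "x \<bullet> (mat22 (b\<^sup>2 / a) b b a *v x) = (b * x $ 0 + a * x $ 1)\<^sup>2 / a"
      by (simp add: mat22_def inner_vec_def matrix_vector_mult_def UNIV_2_zero_one
          field_simps power2_eq_square)
    then show ?thesis using assms by simp
  qed
  then show ?thesis
    by (auto simp: is_cov_def mat22_def transpose_def vec_eq_iff)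
qed

text \<open>Reduces a steady-state claim to solving the fixed-point equations for the entries
  selected by \<open>I\<close>; \<open>is_cov_mat22\<close> completes the solution to a
  covariance.\<close>

lemma steady_state_iff:
  assumes F: "\<And>P. is_cov P \<Longrightarrow> (\<forall>i\<in>I. F P $ i $ 1 = P $ i $ 1) \<longleftrightarrow>
      (\<forall>i\<in>I. P $ i $ 1 = (if i = 0 then b else a))"
    and ab: "0 \<le> a" "a = 0 \<Longrightarrow> b = 0"
    and q: "\<And>P. (\<forall>i\<in>I. P $ i $ 1 = (if i = 0 then b else a)) \<Longrightarrow> q P = L"
  shows "steady_state F I q v \<longleftrightarrow> v = L"
proof
  assume "steady_state F I q v"
  then show "v = L" using F q unfolding steady_state_def by metis
next
  assume v: "v = L"
  let ?P = "mat22 (b\<^sup>2 / a) b b a"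
  have P: "\<forall>i\<in>I. ?P $ i $ 1 = (if i = 0 then b else a)"
    by (simp add: mat22_def)
  show "steady_state F I q v"
    unfolding steady_state_def using F[of ?P] P q[OF P] v is_cov_mat22[OF ab] by blast
qed

text \<open>Once the perturbation is below \<open>(1 - \<rho>) * (d / 2)\<close>, the level
  \<open>d / 2\<close> is a fixed point of the majorizing recursion
  \<open>t \<mapsto> \<rho> * t + (1 - \<rho>) * (d / 2)\<close>, and only a geometric transient has
  to be added to it.\<close>

lemma perturbed_contraction_tendsto_0:
  fixes x e :: "nat \<Rightarrow> real"
  assumes \<rho>: "0 \<le> \<rho>" "\<rho> < 1" and x: "\<And>n. \<bar>x (Suc n)\<bar> \<le> \<rho> * \<bar>x n\<bar> + \<bar>e n\<bar>"
    and e: "e \<longlonglongrightarrow> 0"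
  shows "x \<longlonglongrightarrow> 0"
proof (rule LIMSEQ_I)
  fix d :: real assume d: "0 < d"
  obtain N where N: "\<And>n. n \<ge> N \<Longrightarrow> \<bar>e n\<bar> < (1 - \<rho>) * (d / 2)"
    using LIMSEQ_D[OF e, of "(1 - \<rho>) * (d / 2)"] d \<rho> by auto
  have bound: "\<bar>x (N + n)\<bar> \<le> \<rho> ^ n * \<bar>x N\<bar> + d / 2" for n
  proof (induction n)
    case 0
    then show ?case using d by simp
  next
    case (Suc n)
    have "\<bar>x (N + Suc n)\<bar> \<le> \<rho> * \<bar>x (N + n)\<bar> + (1 - \<rho>) * (d / 2)"
      using x[of "N + n"] N[of "N + n"] by simp
    also have "\<dots> \<le> \<rho> * (\<rho> ^ n * \<bar>x N\<bar> + d / 2) + (1 - \<rho>) * (d / 2)"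
      using mult_left_mono[OF Suc \<rho>(1)] by simp
    finally show ?case by (simp add: field_simps)
  qed
  have "(\<lambda>n. \<rho> ^ n * \<bar>x N\<bar>) \<longlonglongrightarrow> 0 * \<bar>x N\<bar>"
    using \<rho> by (intro tendsto_mult LIMSEQ_power_zero tendsto_const) auto
  then obtain M where M: "\<And>n. n \<ge> M \<Longrightarrow> \<rho> ^ n * \<bar>x N\<bar> < d / 2"
    using LIMSEQ_D[of "\<lambda>n. \<rho> ^ n * \<bar>x N\<bar>" 0 "d / 2"] d by fastforce
  have "norm (x n - 0) < d" if "n \<ge> N + M" for n
  proof -
    have "\<bar>x n\<bar> \<le> \<rho> ^ (n - N) * \<bar>x N\<bar> + d / 2" using bound[of "n - N"] that by simp
    moreover have "\<rho> ^ (n - N) * \<bar>x N\<bar> < d / 2" using that by (intro M) simp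
    ultimately show ?thesis by simp
  qed
  then show "\<exists>no. \<forall>n\<ge>no. norm (x n - 0) < d" by blast
qed

subsection \<open>Steady states of one coordinate\<close>

text \<open>\<open>r\<close> is the value of \<open>R\<close> at the given step size;
  \<open>r = 0\<close> is allowed, which covers \<open>p = \<infinity>\<close>.\<close>

locale coordinate =
  fixes h \<sigma> r :: real
  assumes h: "0 < h" and \<sigma>: "0 < \<sigma>" and r: "0 \<le> r"
begin

definition S :: real where "S = sqrt (4 * \<sigma>\<^sup>2 * r * h + \<sigma> ^ 4 * h\<^sup>2)"

definition X :: real where "X = (\<sigma>\<^sup>2 * h + S) / 2"

lemma noise_pos: "0 < \<sigma>\<^sup>2 * h"
  using h \<sigma> by simp

lemma S_eq: "S = 2 * X - \<sigma>\<^sup>2 * h"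
  by (simp add: X_def field_simps)

lemma riccati: "X\<^sup>2 = \<sigma>\<^sup>2 * h * (X + r)"
proof -
  have "S\<^sup>2 = 4 * \<sigma>\<^sup>2 * r * h + \<sigma> ^ 4 * h\<^sup>2"
    unfolding S_def using h \<sigma> r by simp
  then show ?thesis
    by (simp add: X_def field_simps power2_eq_square power4_eq_xxxx)
qed

lemma X_ge: "\<sigma>\<^sup>2 * h \<le> X"
proof -
  have "sqrt ((\<sigma>\<^sup>2 * h)\<^sup>2) \<le> S"
    unfolding S_def using h \<sigma> r by (intro real_sqrt_le_mono) (simp add: power_mult_distrib)
  then have "\<sigma>\<^sup>2 * h \<le> S" using noise_pos by (simp only: real_sqrt_abs abs_of_pos)
  then show ?thesis by (simp add: X_def field_simps)
qed

lemma X_pos: "0 < X"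
  using X_ge noise_pos by linarith

text \<open>\<open>A\<close> and \<open>B\<close> are the limits of P_11 and P_01 after the update;
  \<open>X\<close> and \<open>B'\<close> are the corresponding limits before it.\<close>

definition A :: real where "A = X * r / (X + r)"

definition B :: real where "B = r * S / (2 * X) * h"

lemma A_eq: "A = X - \<sigma>\<^sup>2 * h"
proof -
  have "(X - \<sigma>\<^sup>2 * h) * (X + r) = X * r"
    using riccati by (simp add: algebra_simps power2_eq_square)
  then show ?thesis using X_pos r by (simp add: A_def field_simps)
qed

lemma A_nonneg: "0 \<le> A"
  using X_ge A_eq by simp

text \<open>A short form of the limit of the predicted P_01, convenient for the algebra;
  \<open>B'_closed_form\<close> recovers the stated one.\<close>

definition B' :: real where "B' = h * (r + X / 2)"

lemma S_div: "S / (2 * X) = (r + X / 2) / (X + r)"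
proof -
  have "S * (X + r) = 2 * X * (r + X / 2)"
    using riccati by (simp add: S_eq algebra_simps power2_eq_square)
  then show ?thesis using X_pos r by (simp add: field_simps)
qed

lemma B_eq: "B = B' * r / (X + r)"
proof -
  have "B = r * (S / (2 * X)) * h" by (simp add: B_def)
  then show ?thesis unfolding S_div by (simp add: B'_def)
qed

text \<open>Expanding \<open>(r + X / 2) * (X + r)\<close> leaves the term
  \<open>X\<^sup>2 / 2\<close>, which the Riccati equation turns into
  \<open>\<sigma>\<^sup>2 * h / 2 * (X + r)\<close>, that is, into the noise term after division by
  \<open>X + r\<close>.\<close>

lemma B'_eq: "B' = B + h * A + \<sigma>\<^sup>2 * h\<^sup>2 / 2"
proof -
  have "(r + X / 2) * (X + r) = (r + X / 2) * r + X * r + X\<^sup>2 / 2"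
    by (simp add: field_simps power2_eq_square)
  then have "(r + X / 2) * (X + r) = (r + X / 2) * r + X * r + \<sigma>\<^sup>2 * h / 2 * (X + r)"
    using riccati by simp
  then have "r + X / 2 = ((r + X / 2) * r + X * r + \<sigma>\<^sup>2 * h / 2 * (X + r)) / (X + r)"
    using X_pos r by (simp add: field_simps)
  also have "\<dots> = (r + X / 2) * r / (X + r) + X * r / (X + r) + \<sigma>\<^sup>2 * h / 2"
    using X_pos r by (simp only: add_divide_distrib) (subst nonzero_mult_div_cancel_right, auto)
  finally have "h * (r + X / 2) = h * ((r + X / 2) * r / (X + r) + X * r / (X + r) + \<sigma>\<^sup>2 * h / 2)"
    by simp
  moreover have "h * (u * r / d + v + c * h / 2) = h * u * r / d + h * v + c * h\<^sup>2 / 2"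
    for u d v c :: real by (simp add: algebra_simps power2_eq_square)
  ultimately show ?thesis
    unfolding B_eq A_def B'_def by simp
qed

lemma A_0_B_0: "A = 0 \<Longrightarrow> B = 0"
  using X_pos r unfolding A_def B_def by auto

text \<open>Subtracting the two Riccati equations and cancelling \<open>x - X\<close> leaves
  \<open>x + X = \<sigma>\<^sup>2 * h\<close>, which is impossible because \<open>X\<close> alone is
  that large and \<open>x\<close> is positive.\<close>

lemma riccati_unique:
  assumes "0 < x" "x\<^sup>2 = \<sigma>\<^sup>2 * h * (x + r)"
  shows "x = X"
proof (rule ccontr)
  assume ne: "x \<noteq> X"
  have "(x - X) * (x + X) = (x - X) * (\<sigma>\<^sup>2 * h)"
    using assms riccati by (simp add: algebra_simps power2_eq_square)
  then have "x + X = \<sigma>\<^sup>2 * h" using ne by simp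
  then show False using X_ge assms by simp
qed

section \<open>Fixed points of the recursions after and before the update\<close>

lemma predict_1_1_pos:
  assumes "0 \<le> P $ 1 $ 1"
  shows "0 < predict h \<sigma> P $ 1 $ 1"
  using assms noise_pos by (simp add: predict_1_1)

lemma cov_step_1:
  assumes "0 \<le> P $ 1 $ 1"
  shows "cov_step h \<sigma> r P $ i $ 1 = predict h \<sigma> P $ i $ 1 * r / (P $ 1 $ 1 + \<sigma>\<^sup>2 * h + r)"
  using predict_1_1_pos[OF assms] r unfolding cov_step_def
  by (subst update_1) (auto simp: predict_1_1)

lemma cov_step_1_1_fixed:
  assumes P: "0 \<le> P $ 1 $ 1"
  shows "cov_step h \<sigma> r P $ 1 $ 1 = P $ 1 $ 1 \<longleftrightarrow> P $ 1 $ 1 = A"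
proof -
  \<comment> \<open>In terms of the predicted entry the fixed-point equation becomes the Riccati
    equation.\<close>
  define x where "x = P $ 1 $ 1 + \<sigma>\<^sup>2 * h"
  have x: "0 < x" using P noise_pos by (simp add: x_def)
  have "cov_step h \<sigma> r P $ 1 $ 1 = P $ 1 $ 1 \<longleftrightarrow> x * r / (x + r) = x - \<sigma>\<^sup>2 * h"
    by (simp add: cov_step_1[OF P] predict_1_1 x_def)
  also have "\<dots> \<longleftrightarrow> x * r = (x - \<sigma>\<^sup>2 * h) * (x + r)"
    using x r by (simp add: divide_eq_eq)
  also have "\<dots> \<longleftrightarrow> x\<^sup>2 = \<sigma>\<^sup>2 * h * (x + r)"
    by (auto simp: algebra_simps power2_eq_square)
  also have "\<dots> \<longleftrightarrow> x = X" using riccati riccati_unique[OF x] by blast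
  finally show ?thesis by (auto simp: x_def A_eq)
qed

text \<open>With P_11 frozen at \<open>A\<close> the map is affine in P_01, fixes \<open>B\<close>
  and has slope \<open>r / (X + r) < 1\<close>.\<close>

lemma cov_step_0_1_fixed:
  assumes P: "P $ 1 $ 1 = A"
  shows "cov_step h \<sigma> r P $ 0 $ 1 = P $ 0 $ 1 \<longleftrightarrow> P $ 0 $ 1 = B"
proof -
  define y where "y = P $ 0 $ 1"
  have AX: "A + \<sigma>\<^sup>2 * h = X" by (simp add: A_eq)
  have "cov_step h \<sigma> r P $ 0 $ 1 = (y - B + B') * r / (X + r)"
    using P A_nonneg by (simp add: cov_step_1 predict_0_1 AX y_def B'_eq)
  also have "\<dots> = (y - B) * r / (X + r) + B"
    by (simp add: B_eq add_divide_distrib diff_divide_distrib algebra_simps)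
  finally have "cov_step h \<sigma> r P $ 0 $ 1 = y \<longleftrightarrow> (y - B) * r / (X + r) = y - B"
    by auto
  also have "\<dots> \<longleftrightarrow> (y - B) * r = (y - B) * (X + r)"
    using X_pos r by (simp add: divide_eq_eq)
  also have "\<dots> \<longleftrightarrow> y = B" using X_pos by auto
  finally show ?thesis by (simp add: y_def)
qed

lemma pred_step_1_1_fixed:
  assumes P: "0 \<le> P $ 1 $ 1"
  shows "pred_step h \<sigma> r P $ 1 $ 1 = P $ 1 $ 1 \<longleftrightarrow> P $ 1 $ 1 = X"
\<comment> \<open>If \<open>r = 0\<close> as well, the denominator in \<open>update\<close> vanishes
  and \<open>update_1\<close> does not apply; unfolding \<open>update\<close> gives the value
  directly.\<close>
proof (cases "P $ 1 $ 1 = 0")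
  case True
  then have "pred_step h \<sigma> r P $ 1 $ 1 = \<sigma>\<^sup>2 * h"
    by (simp add: pred_step_def predict_1_1 update_def)
  then show ?thesis using True X_pos noise_pos by linarith
next
  case False
  define x where "x = P $ 1 $ 1"
  have x: "0 < x" using P False by (simp add: x_def)
  have "pred_step h \<sigma> r P $ 1 $ 1 = x * r / (x + r) + \<sigma>\<^sup>2 * h"
    using x r by (simp add: pred_step_def predict_1_1 update_1 x_def)
  then have "pred_step h \<sigma> r P $ 1 $ 1 = x \<longleftrightarrow> x * r / (x + r) = x - \<sigma>\<^sup>2 * h" by auto
  also have "\<dots> \<longleftrightarrow> x * r = (x - \<sigma>\<^sup>2 * h) * (x + r)"
    using x r by (simp add: divide_eq_eq)
  also have "\<dots> \<longleftrightarrow> x\<^sup>2 = \<sigma>\<^sup>2 * h * (x + r)"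
    by (auto simp: algebra_simps power2_eq_square)
  also have "\<dots> \<longleftrightarrow> x = X" using riccati riccati_unique[OF x] by blast
  finally show ?thesis by (simp add: x_def)
qed

lemma pred_step_0_1_fixed:
  assumes P: "P $ 1 $ 1 = X"
  shows "pred_step h \<sigma> r P $ 0 $ 1 = P $ 0 $ 1 \<longleftrightarrow> P $ 0 $ 1 = B'"
proof -
  define y where "y = P $ 0 $ 1"
  have "pred_step h \<sigma> r P $ 0 $ 1 = y * r / (X + r) + h * A + \<sigma>\<^sup>2 * h\<^sup>2 / 2"
    using P X_pos r by (simp add: pred_step_def predict_0_1 update_1 y_def A_def)
  also have "\<dots> = (y - B') * r / (X + r) + B'"
    unfolding B'_eq using B_eq[unfolded B'_eq]
    by (simp add: diff_divide_distrib left_diff_distrib)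
  finally have "pred_step h \<sigma> r P $ 0 $ 1 = y \<longleftrightarrow> (y - B') * r / (X + r) = y - B'"
    by auto
  also have "\<dots> \<longleftrightarrow> (y - B') * r = (y - B') * (X + r)"
    using X_pos r by (simp add: divide_eq_eq)
  also have "\<dots> \<longleftrightarrow> y = B'" using X_pos by auto
  finally show ?thesis by (simp add: y_def)
qed

section \<open>Convergence from every initial covariance\<close>

lemma cov_1_1_nonneg: "0 \<le> P $ 1 $ 1 \<Longrightarrow> 0 \<le> cov h \<sigma> r P n $ 1 $ 1"
proof (induction n)
  case (Suc n)
  then show ?case using noise_pos r by (simp add: cov_step_1 predict_1_1)
qed simp

lemma cov_Suc_1:
  assumes "0 \<le> P $ 1 $ 1"
  shows "cov h \<sigma> r P (Suc n) $ i $ 1 =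
    predict h \<sigma> (cov h \<sigma> r P n) $ i $ 1 * r / (cov h \<sigma> r P n $ 1 $ 1 + \<sigma>\<^sup>2 * h + r)"
  using cov_step_1[OF cov_1_1_nonneg[OF assms]] by simp

text \<open>The noise added in each prediction keeps the contraction factors below one constant less
  than 1, uniformly over the steps.\<close>

lemma ratio_le:
  assumes "0 \<le> a"
  shows "r / (a + \<sigma>\<^sup>2 * h + r) \<le> r / (\<sigma>\<^sup>2 * h + r)"
  using assms noise_pos r by (intro divide_left_mono) auto

lemma cov_1_1_tendsto:
  assumes P: "0 \<le> P $ 1 $ 1"
  shows "(\<lambda>n. cov h \<sigma> r P n $ 1 $ 1) \<longlonglongrightarrow> A"
proof -
  define a where "a n = cov h \<sigma> r P n $ 1 $ 1" for n
  define \<rho> where "\<rho> = r / (\<sigma>\<^sup>2 * h + r)"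
  have \<rho>: "0 \<le> \<rho>" "\<rho> < 1" using noise_pos r by (auto simp: \<rho>_def)
  have a: "0 \<le> a n" for n using cov_1_1_nonneg[OF P] by (simp add: a_def)
  have "\<bar>a (Suc n) - A\<bar> \<le> \<rho> * \<bar>a n - A\<bar> + \<bar>0\<bar>" for n
  proof -
    define x where "x = a n + \<sigma>\<^sup>2 * h"
    have x: "0 < x" using a[of n] noise_pos by (simp add: x_def)
    have "a (Suc n) - A = x * r / (x + r) - X * r / (X + r)"
      unfolding a_def cov_Suc_1[OF P] A_def by (simp add: predict_1_1 x_def a_def)
    \<comment> \<open>The difference of the update map at two points carries one factor
      \<open>r / (\<cdot> + r)\<close> for each point; the first is at most \<open>\<rho>\<close>,
      the second at most 1.\<close>
    also have "\<dots> = r / (x + r) * (r / (X + r)) * (x - X)"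
      using x X_pos r by (simp add: field_simps)
    also have "x - X = a n - A" by (simp add: x_def A_eq)
    finally have "\<bar>a (Suc n) - A\<bar> = r / (x + r) * (r / (X + r)) * \<bar>a n - A\<bar>"
      using x X_pos r by (simp add: abs_mult)
    also have "\<dots> \<le> \<rho> * 1 * \<bar>a n - A\<bar>"
      using x X_pos r ratio_le[OF a[of n]] \<rho>
      by (intro mult_right_mono mult_mono) (auto simp: \<rho>_def x_def)
    finally show ?thesis by simp
  qed
  then have "(\<lambda>n. a n - A) \<longlonglongrightarrow> 0"
    by (rule perturbed_contraction_tendsto_0[OF \<rho>, where e = "\<lambda>_. 0"]) simp
  then show ?thesis by (simp add: a_def LIM_zero_iff)
qed

lemma cov_0_1_tendsto:
  assumes P: "0 \<le> P $ 1 $ 1"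
  shows "(\<lambda>n. cov h \<sigma> r P n $ 0 $ 1) \<longlonglongrightarrow> B"
proof -
  define a where "a n = cov h \<sigma> r P n $ 1 $ 1" for n
  define b where "b n = cov h \<sigma> r P n $ 0 $ 1" for n
  define \<rho> where "\<rho> = r / (\<sigma>\<^sup>2 * h + r)"
  define \<rho>' where "\<rho>' n = r / (a n + \<sigma>\<^sup>2 * h + r)" for n
  \<comment> \<open>The defect of the constant value \<open>B\<close> in the nth linear step. It
    vanishes in the limit, because \<open>a\<close> tends to \<open>A\<close> and \<open>B\<close>
    is fixed at \<open>A\<close>.\<close>
  define e where "e n = \<rho>' n * (B + h * a n + \<sigma>\<^sup>2 * h\<^sup>2 / 2) - B" for n
  have \<rho>: "0 \<le> \<rho>" "\<rho> < 1" using noise_pos r by (auto simp: \<rho>_def)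
  have a: "0 \<le> a n" for n using cov_1_1_nonneg[OF P] by (simp add: a_def)
  have alim: "a \<longlonglongrightarrow> A" using cov_1_1_tendsto[OF P] unfolding a_def .
  have AX: "A + \<sigma>\<^sup>2 * h = X" by (simp add: A_eq)
  have "\<rho>' \<longlonglongrightarrow> r / (A + \<sigma>\<^sup>2 * h + r)"
    unfolding \<rho>'_def using alim AX X_pos r by (intro tendsto_intros) auto
  then have "e \<longlonglongrightarrow> r / (A + \<sigma>\<^sup>2 * h + r) * (B + h * A + \<sigma>\<^sup>2 * h\<^sup>2 / 2) - B"
    unfolding e_def by (intro tendsto_intros alim)
  also have "r / (A + \<sigma>\<^sup>2 * h + r) * (B + h * A + \<sigma>\<^sup>2 * h\<^sup>2 / 2) - B = 0"
    unfolding AX B'_eq[symmetric] by (subst B_eq) simp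
  finally have e: "e \<longlonglongrightarrow> 0" .
  have "\<bar>b (Suc n) - B\<bar> \<le> \<rho> * \<bar>b n - B\<bar> + \<bar>e n\<bar>" for n
  proof -
    have "b (Suc n) = \<rho>' n * (b n + h * a n + \<sigma>\<^sup>2 * h\<^sup>2 / 2)"
      unfolding b_def cov_Suc_1[OF P] \<rho>'_def a_def by (simp add: predict_0_1)
    then have "b (Suc n) - B = \<rho>' n * (b n - B) + e n"
      by (simp add: e_def algebra_simps)
    then have "\<bar>b (Suc n) - B\<bar> \<le> \<bar>\<rho>' n\<bar> * \<bar>b n - B\<bar> + \<bar>e n\<bar>"
      by (metis abs_mult abs_triangle_ineq)
    also have "\<bar>\<rho>' n\<bar> * \<bar>b n - B\<bar> \<le> \<rho> * \<bar>b n - B\<bar>"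
      using a[of n] noise_pos r ratio_le[OF a[of n]]
      by (intro mult_right_mono) (auto simp: \<rho>_def \<rho>'_def)
    finally show ?thesis by simp
  qed
  then have "(\<lambda>n. b n - B) \<longlonglongrightarrow> 0"
    by (rule perturbed_contraction_tendsto_0[OF \<rho> _ e])
  then show ?thesis by (simp add: b_def LIM_zero_iff)
qed

text \<open>The prediction with index \<open>Suc n\<close> is computed from the covariance with
  index \<open>n\<close>; shifting the sequence removes the junk value at 0.\<close>

lemma pred_cov_1_1_tendsto:
  assumes P: "0 \<le> P $ 1 $ 1"
  shows "(\<lambda>n. pred_cov h \<sigma> r P n $ 1 $ 1) \<longlonglongrightarrow> X"
proof -
  have "(\<lambda>n. cov h \<sigma> r P n $ 1 $ 1 + \<sigma>\<^sup>2 * h) \<longlonglongrightarrow> A + \<sigma>\<^sup>2 * h"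
    by (intro tendsto_intros cov_1_1_tendsto P)
  then have "(\<lambda>n. pred_cov h \<sigma> r P (Suc n) $ 1 $ 1) \<longlonglongrightarrow> X"
    by (simp add: pred_cov_def predict_1_1 A_eq)
  then show ?thesis by (rule LIMSEQ_imp_Suc)
qed

lemma pred_cov_0_1_tendsto:
  assumes P: "0 \<le> P $ 1 $ 1"
  shows "(\<lambda>n. pred_cov h \<sigma> r P n $ 0 $ 1) \<longlonglongrightarrow> B'"
proof -
  have "(\<lambda>n. cov h \<sigma> r P n $ 0 $ 1 + h * cov h \<sigma> r P n $ 1 $ 1 + \<sigma>\<^sup>2 * h\<^sup>2 / 2)
      \<longlonglongrightarrow> B + h * A + \<sigma>\<^sup>2 * h\<^sup>2 / 2"
    by (intro tendsto_intros cov_1_1_tendsto cov_0_1_tendsto P)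
  then have "(\<lambda>n. pred_cov h \<sigma> r P (Suc n) $ 0 $ 1) \<longlonglongrightarrow> B'"
    by (simp add: pred_cov_def predict_0_1 B'_eq)
  then show ?thesis by (rule LIMSEQ_imp_Suc)
qed

lemma cov_step_fixed:
  assumes "is_cov P"
  shows "(\<forall>i\<in>{1}. cov_step h \<sigma> r P $ i $ 1 = P $ i $ 1) \<longleftrightarrow>
      (\<forall>i\<in>{1}. P $ i $ 1 = (if i = 0 then B else A))"
    and "(\<forall>i\<in>UNIV. cov_step h \<sigma> r P $ i $ 1 = P $ i $ 1) \<longleftrightarrow>
      (\<forall>i\<in>UNIV. P $ i $ 1 = (if i = 0 then B else A))"
  using cov_step_1_1_fixed[OF is_cov_1_1_nonneg[OF assms]] cov_step_0_1_fixed
  by (auto simp: UNIV_2_zero_one)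

lemma pred_step_fixed:
  assumes "is_cov P"
  shows "(\<forall>i\<in>{1}. pred_step h \<sigma> r P $ i $ 1 = P $ i $ 1) \<longleftrightarrow>
      (\<forall>i\<in>{1}. P $ i $ 1 = (if i = 0 then B' else X))"
    and "(\<forall>i\<in>UNIV. pred_step h \<sigma> r P $ i $ 1 = P $ i $ 1) \<longleftrightarrow>
      (\<forall>i\<in>UNIV. P $ i $ 1 = (if i = 0 then B' else X))"
  using pred_step_1_1_fixed[OF is_cov_1_1_nonneg[OF assms]] pred_step_0_1_fixed
  by (auto simp: UNIV_2_zero_one)

text \<open>After eliminating \<open>S\<close>, the Riccati equation turns the numerator into
  \<open>4 * X * (r + X / 2)\<close>, while the denominator is \<open>4 * X\<close>.\<close>

lemma B'_closed_form:
  "B' = (\<sigma> ^ 4 * h\<^sup>2 + (2 * r + \<sigma>\<^sup>2 * h) * S + 4 * r * \<sigma>\<^sup>2 * h) / (2 * (\<sigma>\<^sup>2 * h + S)) * h"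
proof -
  have "\<sigma> ^ 4 * h\<^sup>2 + (2 * r + \<sigma>\<^sup>2 * h) * S + 4 * r * \<sigma>\<^sup>2 * h =
      2 * X * \<sigma>\<^sup>2 * h + 4 * X * r + 2 * (\<sigma>\<^sup>2 * h * r)"
    by (simp add: S_eq algebra_simps power2_eq_square power4_eq_xxxx)
  also have "\<dots> = 4 * X * (r + X / 2)"
    using riccati by (simp add: algebra_simps power2_eq_square)
  finally show ?thesis using X_pos by (simp add: S_eq B'_def)
qed

lemma steady_states:
  "unique_attractive_steady_state (pred_cov h \<sigma> r) (pred_step h \<sigma> r) {1} (\<lambda>P. P $ 1 $ 1)
     ((\<sigma>\<^sup>2 * h + S) / 2)"
  "unique_attractive_steady_state (cov h \<sigma> r) (cov_step h \<sigma> r) {1} (\<lambda>P. P $ 1 $ 1)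
     ((\<sigma>\<^sup>2 * h + S) * r / (\<sigma>\<^sup>2 * h + S + 2 * r))"
  "unique_attractive_steady_state (pred_cov h \<sigma> r) (pred_step h \<sigma> r) UNIV (\<lambda>P. P $ 0 $ 1)
     ((\<sigma> ^ 4 * h\<^sup>2 + (2 * r + \<sigma>\<^sup>2 * h) * S + 4 * r * \<sigma>\<^sup>2 * h) / (2 * (\<sigma>\<^sup>2 * h + S)) * h)"
  "unique_attractive_steady_state (cov h \<sigma> r) (cov_step h \<sigma> r) UNIV (\<lambda>P. P $ 0 $ 1)
     (r * S / (\<sigma>\<^sup>2 * h + S) * h)"
  "unique_attractive_steady_state (pred_cov h \<sigma> r) (pred_step h \<sigma> r) UNIV (gain r 0)
     (S / (\<sigma>\<^sup>2 * h + S) * h)"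
  "unique_attractive_steady_state (pred_cov h \<sigma> r) (pred_step h \<sigma> r) {1} (gain r 1)
     ((\<sigma>\<^sup>2 * h + S) / (\<sigma>\<^sup>2 * h + S + 2 * r))"
proof -
  have X2: "\<sigma>\<^sup>2 * h + S = 2 * X" by (simp add: X_def)
  have Aform: "(\<sigma>\<^sup>2 * h + S) * r / (\<sigma>\<^sup>2 * h + S + 2 * r) = A"
    and g1form: "(\<sigma>\<^sup>2 * h + S) / (\<sigma>\<^sup>2 * h + S + 2 * r) = X / (X + r)"
    and Bform: "r * S / (\<sigma>\<^sup>2 * h + S) * h = B"
    unfolding X2 A_def B_def using X_pos r by (simp_all add: field_simps)
  have g0form: "S / (\<sigma>\<^sup>2 * h + S) * h = B' / (X + r)"
    unfolding X2 S_div B'_def by simp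
  have X0: "X = 0 \<Longrightarrow> B' = 0" "0 \<le> X" using X_pos by auto
  note pred = X0(2) X0(1)
  note upd = A_nonneg A_0_B_0
  have Xr: "X + r \<noteq> 0" using X_pos r by simp
  show "unique_attractive_steady_state (pred_cov h \<sigma> r) (pred_step h \<sigma> r) {1} (\<lambda>P. P $ 1 $ 1)
     ((\<sigma>\<^sup>2 * h + S) / 2)"
    unfolding X_def[symmetric] unique_attractive_steady_state_def
    using pred_cov_1_1_tendsto is_cov_1_1_nonneg
    by (auto simp: steady_state_iff[OF pred_step_fixed(1) pred])
  show "unique_attractive_steady_state (cov h \<sigma> r) (cov_step h \<sigma> r) {1} (\<lambda>P. P $ 1 $ 1)
     ((\<sigma>\<^sup>2 * h + S) * r / (\<sigma>\<^sup>2 * h + S + 2 * r))"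
    unfolding Aform unique_attractive_steady_state_def
    using cov_1_1_tendsto is_cov_1_1_nonneg
    by (auto simp: steady_state_iff[OF cov_step_fixed(1) upd])
  show "unique_attractive_steady_state (pred_cov h \<sigma> r) (pred_step h \<sigma> r) UNIV (\<lambda>P. P $ 0 $ 1)
     ((\<sigma> ^ 4 * h\<^sup>2 + (2 * r + \<sigma>\<^sup>2 * h) * S + 4 * r * \<sigma>\<^sup>2 * h) / (2 * (\<sigma>\<^sup>2 * h + S)) * h)"
    unfolding B'_closed_form[symmetric] unique_attractive_steady_state_def
    using pred_cov_0_1_tendsto is_cov_1_1_nonneg
    by (auto simp: steady_state_iff[OF pred_step_fixed(2) pred])
  show "unique_attractive_steady_state (cov h \<sigma> r) (cov_step h \<sigma> r) UNIV (\<lambda>P. P $ 0 $ 1)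
     (r * S / (\<sigma>\<^sup>2 * h + S) * h)"
    unfolding Bform unique_attractive_steady_state_def
    using cov_0_1_tendsto is_cov_1_1_nonneg
    by (auto simp: steady_state_iff[OF cov_step_fixed(2) upd])
  show "unique_attractive_steady_state (pred_cov h \<sigma> r) (pred_step h \<sigma> r) UNIV (gain r 0)
     (S / (\<sigma>\<^sup>2 * h + S) * h)"
    unfolding g0form unique_attractive_steady_state_def
    using tendsto_divide[OF pred_cov_0_1_tendsto tendsto_add[OF pred_cov_1_1_tendsto tendsto_const[of r]] Xr]
      is_cov_1_1_nonneg
    by (auto simp: steady_state_iff[OF pred_step_fixed(2) pred] gain_def)
  show "unique_attractive_steady_state (pred_cov h \<sigma> r) (pred_step h \<sigma> r) {1} (gain r 1)
     ((\<sigma>\<^sup>2 * h + S) / (\<sigma>\<^sup>2 * h + S + 2 * r))"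
    unfolding g1form unique_attractive_steady_state_def
    using tendsto_divide[OF pred_cov_1_1_tendsto tendsto_add[OF pred_cov_1_1_tendsto tendsto_const[of r]] Xr]
      is_cov_1_1_nonneg
    by (auto simp: steady_state_iff[OF pred_step_fixed(1) pred] gain_def)
qed

end

subsection \<open>Orders in one coordinate\<close>

lemma harmonic_mono:
  fixes a b r :: real
  assumes "0 \<le> a" "a \<le> b" "0 < b" "0 \<le> r"
  shows "a * r / (a + r) \<le> b * r / (b + r)"
proof (cases "r = 0")
  case False
  then have "0 < a + r" "0 < b + r" using assms by auto
  moreover have "a * r * r \<le> b * r * r" using assms by (intro mult_right_mono) auto
  ultimately show ?thesis by (simp add: divide_simps algebra_simps)
qed simp

text \<open>The quotient is \<open>min a r\<close> times \<open>max a r / (a + r)\<close>, and the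
  maximum is at least half the sum.\<close>

lemma harmonic_ge_half_min:
  fixes a r :: real
  assumes "0 < a" "0 \<le> r"
  shows "min a r / 2 \<le> a * r / (a + r)"
proof -
  have "min a r * (a + r) \<le> 2 * (a * r)"
  proof (cases "a \<le> r")
    case True
    then have "a * a \<le> a * r" using assms by (intro mult_left_mono) auto
    then show ?thesis using True by (simp add: algebra_simps)
  next
    case False
    then have "r * r \<le> a * r" using assms by (intro mult_right_mono) auto
    then show ?thesis using False by (simp add: algebra_simps)
  qed
  then show ?thesis using assms by (simp add: divide_simps)
qed

section \<open>Bounds along one trajectory at a fixed step size\<close>

locale trajectory = coordinate +
  fixes P :: "real ^ 2 ^ 2"
  assumes P: "0 \<le> P $ 1 $ 1"
begin

definition x :: "nat \<Rightarrow> real" where "x n = pred_cov h \<sigma> r P (Suc n) $ 1 $ 1"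

definition y :: "nat \<Rightarrow> real" where "y n = pred_cov h \<sigma> r P (Suc n) $ 0 $ 1"

lemma x_0: "x 0 = P $ 1 $ 1 + \<sigma>\<^sup>2 * h"
  by (simp add: x_def pred_cov_def predict_1_1)

lemma y_0: "y 0 = P $ 0 $ 1 + h * P $ 1 $ 1 + \<sigma>\<^sup>2 * h\<^sup>2 / 2"
  by (simp add: y_def pred_cov_def predict_0_1)

lemma x_ge: "\<sigma>\<^sup>2 * h \<le> x n"
  using cov_1_1_nonneg[OF P] by (simp add: x_def pred_cov_def predict_1_1)

lemma x_pos: "0 < x n"
  using x_ge[of n] noise_pos by linarith

lemma xr_pos: "0 < x n + r"
  using x_pos[of n] r by linarith

lemma cov_Suc_1_1: "cov h \<sigma> r P (Suc n) $ 1 $ 1 = x n * r / (x n + r)"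
  by (simp only: cov_Suc_1[OF P] x_def pred_cov_def predict_1_1 diff_Suc_1)

lemma cov_Suc_0_1: "cov h \<sigma> r P (Suc n) $ 0 $ 1 = y n * r / (x n + r)"
  by (simp only: cov_Suc_1[OF P] x_def y_def pred_cov_def predict_1_1 diff_Suc_1)

lemma gain_0: "gain r 0 (pred_cov h \<sigma> r P (Suc n)) = y n / (x n + r)"
  by (simp add: gain_def x_def y_def)

lemma gain_1: "1 - gain r 1 (pred_cov h \<sigma> r P (Suc n)) = r / (x n + r)"
  using xr_pos[of n] by (simp add: gain_def x_def[symmetric] field_simps)

lemma x_Suc: "x (Suc n) = x n * r / (x n + r) + \<sigma>\<^sup>2 * h"
  using cov_Suc_1_1[of n] by (simp only: x_def pred_cov_def predict_1_1 diff_Suc_1)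

lemma y_Suc:
  "y (Suc n) = y n * r / (x n + r) + h * (x n * r / (x n + r)) + \<sigma>\<^sup>2 * h\<^sup>2 / 2"
  using cov_Suc_1_1[of n] cov_Suc_0_1[of n]
  by (simp only: x_def y_def pred_cov_def predict_0_1 diff_Suc_1)

lemma x_le: "x n \<le> x 0 + \<sigma>\<^sup>2 * h + sqrt (\<sigma>\<^sup>2 * h * r)"
proof -
  define q where "q = sqrt (\<sigma>\<^sup>2 * h * r)"
  \<comment> \<open>\<open>M\<close> is a supersolution of the Riccati equation,
    \<open>M\<^sup>2 \<ge> \<sigma>\<^sup>2 * h * (M + r)\<close>, since
    \<open>M \<ge> \<sigma>\<^sup>2 * h + q\<close> and
    \<open>q\<^sup>2 = \<sigma>\<^sup>2 * h * r\<close>. A step therefore maps \<open>M\<close> to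
    at most \<open>M\<close>, and monotonicity keeps \<open>x\<close> below it.\<close>
  define M where "M = x 0 + \<sigma>\<^sup>2 * h + q"
  have q: "0 \<le> q" "q * q = \<sigma>\<^sup>2 * h * r" using noise_pos r by (auto simp: q_def)
  have M: "\<sigma>\<^sup>2 * h + q \<le> M" "0 < M" using x_pos[of 0] noise_pos q by (auto simp: M_def)
  have "q * q \<le> M * q" using M q noise_pos by (intro mult_right_mono) linarith+
  moreover have "M * (\<sigma>\<^sup>2 * h + q) \<le> M * M" using M by (intro mult_left_mono) auto
  ultimately have "M * r + \<sigma>\<^sup>2 * h * (M + r) \<le> M * (M + r)"
    using q by (simp add: algebra_simps)
  then have fixed: "M * r / (M + r) + \<sigma>\<^sup>2 * h \<le> M"
    using M r by (simp add: field_simps)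
  have "x n \<le> M"
  proof (induction n)
    case 0
    then show ?case using noise_pos q by (simp add: M_def)
  next
    case (Suc n)
    have "x n * r / (x n + r) \<le> M * r / (M + r)"
      using Suc x_pos[of n] M r by (intro harmonic_mono) auto
    then show ?case using fixed by (simp add: x_Suc)
  qed
  then show ?thesis by (simp add: M_def q_def)
qed

text \<open>The weight \<open>h * (x n + r)\<close> is adapted to the recursion: the factor
  \<open>r / (x n + r)\<close> leaves at most \<open>K * h * r\<close> of the old value, and the
  added terms are at most \<open>h * x (Suc n)\<close>, where \<open>K \<ge> 1\<close> comes
  in.\<close>

lemma abs_y_le:
  assumes "1 \<le> K" and y0: "\<bar>y 0\<bar> \<le> K * h * (x 0 + r)"
  shows "\<bar>y n\<bar> \<le> K * h * (x n + r)"
proof (induction n)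
  case 0
  then show ?case using y0 .
next
  case (Suc n)
  define a where "a = x n * r / (x n + r)"
  have a: "0 \<le> a" using x_pos[of n] r by (simp add: a_def)
  have "\<bar>y n * r / (x n + r)\<bar> = \<bar>y n\<bar> * (r / (x n + r))"
    using xr_pos[of n] r by (simp add: abs_mult)
  also have "\<dots> \<le> K * h * (x n + r) * (r / (x n + r))"
    using Suc xr_pos[of n] r by (intro mult_right_mono) auto
  also have "\<dots> = K * h * r" using xr_pos[of n] by simp
  finally have 1: "\<bar>y n * r / (x n + r)\<bar> \<le> K * h * r" .
  have "1 * (h * (a + \<sigma>\<^sup>2 * h)) \<le> K * (h * (a + \<sigma>\<^sup>2 * h))"
    using assms a h by (intro mult_right_mono) auto
  moreover have "0 \<le> \<sigma>\<^sup>2 * h\<^sup>2" "0 \<le> h * a" using a h by auto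
  ultimately have 2: "\<bar>h * a + \<sigma>\<^sup>2 * h\<^sup>2 / 2\<bar> \<le> K * (h * (a + \<sigma>\<^sup>2 * h))"
    by (simp add: algebra_simps power2_eq_square)
  have "\<bar>y (Suc n)\<bar> \<le> \<bar>y n * r / (x n + r)\<bar> + \<bar>h * a + \<sigma>\<^sup>2 * h\<^sup>2 / 2\<bar>"
    unfolding y_Suc a_def[symmetric] by linarith
  also have "\<dots> \<le> K * h * r + K * (h * (a + \<sigma>\<^sup>2 * h))" using 1 2 by linarith
  also have "\<dots> = K * h * (x (Suc n) + r)"
    unfolding x_Suc a_def[symmetric] by (simp add: algebra_simps)
  finally show ?case .
qed

text \<open>Below the threshold the Riccati loss \<open>x\<^sup>2 / (x + r)\<close> is at most half of the added noise \<open>\<sigma>\<^sup>2 h\<close>.\<close>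

lemma x_growth: "min (sqrt (\<sigma>\<^sup>2 * h * r / 2)) (real (Suc n) * (\<sigma>\<^sup>2 * h / 2)) \<le> x n"
proof (cases "r = 0")
  case True
  then show ?thesis using x_pos[of n] by (simp add: min_le_iff_disj)
next
  case False
  define q where "q = sqrt (\<sigma>\<^sup>2 * h * r / 2)"
  have q: "0 \<le> q" "q * q = \<sigma>\<^sup>2 * h / 2 * r" using noise_pos r by (auto simp: q_def)
  have "min q (real (Suc n) * (\<sigma>\<^sup>2 * h / 2)) \<le> x n"
  proof (induction n)
    case 0
    then show ?case using x_ge[of 0] noise_pos by (simp add: min_le_iff_disj)
  next
    case (Suc n)
    \<comment> \<open>\<open>x n\<close> itself may exceed the threshold \<open>q\<close>, so the
      loss is estimated at the truncated lower bound \<open>z\<close> and the result is carried over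
      to \<open>x n\<close> by monotonicity.\<close>
    define z where "z = min q (real (Suc n) * (\<sigma>\<^sup>2 * h / 2))"
    have z: "0 \<le> z" "z \<le> q" "z \<le> x n" using q noise_pos Suc by (auto simp: z_def)
    have "z * z \<le> \<sigma>\<^sup>2 * h / 2 * r" using mult_mono[OF z(2) z(2)] q z by simp
    then have "z * (z + r) \<le> z * r + \<sigma>\<^sup>2 * h / 2 * (z + r)"
      using mult_nonneg_nonneg[OF less_imp_le[OF noise_pos] z(1)] by (simp add: algebra_simps)
    then have "z \<le> (z * r + \<sigma>\<^sup>2 * h / 2 * (z + r)) / (z + r)"
      using z r False by (simp add: pos_le_divide_eq)
    also have "\<dots> = z * r / (z + r) + \<sigma>\<^sup>2 * h / 2"
      using z r False by (simp only: add_divide_distrib) (subst nonzero_mult_div_cancel_right, auto)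
    also have "z * r / (z + r) \<le> x n * r / (x n + r)"
      using z x_pos[of n] r by (intro harmonic_mono) auto
    finally have "z + \<sigma>\<^sup>2 * h / 2 \<le> x (Suc n)" by (simp add: x_Suc)
    moreover have "min q (real (Suc (Suc n)) * (\<sigma>\<^sup>2 * h / 2)) \<le> z + \<sigma>\<^sup>2 * h / 2"
      using noise_pos by (auto simp: z_def min_def field_simps)
    ultimately show ?case by linarith
  qed
  then show ?thesis by (simp add: q_def)
qed

text \<open>While \<open>u k = y k - \<kappa> * h * (x k + r)\<close> is nonpositive, multiplication
  by a factor in [0, 1] cannot lower it, and \<open>\<kappa> \<le> 1 / 4\<close> leaves a gain of at
  least \<open>\<sigma>\<^sup>2 * h\<^sup>2 / 4\<close> per step. The initial deficit is thus used
  up within \<open>n\<close> steps.\<close>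

lemma ex_y_gt:
  assumes \<kappa>: "0 \<le> \<kappa>" "\<kappa> \<le> 1 / 4"
    and start: "\<kappa> * h * (x 0 + r) - y 0 < real n * (\<sigma>\<^sup>2 * h\<^sup>2 / 4)"
  shows "\<exists>k\<le>n. \<kappa> * h * (x k + r) < y k"
proof (rule ccontr)
  assume "\<not> ?thesis"
  then have neg: "y k \<le> \<kappa> * h * (x k + r)" if "k \<le> n" for k using that by force
  define u where "u k = y k - \<kappa> * h * (x k + r)" for k
  have "u 0 + real k * (\<sigma>\<^sup>2 * h\<^sup>2 / 4) \<le> u k" if "k \<le> n" for k
    using that
  proof (induction k)
    case (Suc k)
    define \<rho> where "\<rho> = r / (x k + r)"
    have \<rho>: "0 \<le> \<rho>" "\<rho> \<le> 1" "\<rho> * (x k + r) = r"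
      using x_pos[of k] xr_pos[of k] r by (auto simp: \<rho>_def)
    have "u k \<le> 0" using neg[of k] Suc.prems by (simp add: u_def)
    then have "0 \<le> (1 - \<rho>) * - u k" using \<rho> by (intro mult_nonneg_nonneg) auto
    moreover have "0 \<le> (1 - \<kappa>) * (h * (x k * \<rho>))"
      using \<rho> \<kappa> h x_pos[of k] by (intro mult_nonneg_nonneg) auto
    moreover have "0 \<le> (1 / 4 - \<kappa>) * (\<sigma>\<^sup>2 * h\<^sup>2)"
      using \<kappa> by (intro mult_nonneg_nonneg) auto
    \<comment> \<open>As \<open>\<rho> * (x k + r) = r\<close>, the summand \<open>r\<close> of the
      comparison term is reproduced exactly by \<open>\<rho> * u k\<close>.\<close>
    moreover have "u (Suc k) =
        \<rho> * u k + (1 - \<kappa>) * (h * (x k * \<rho>)) + (1 / 2 - \<kappa>) * (\<sigma>\<^sup>2 * h\<^sup>2)"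
    proof -
      have 1: "\<rho> * u k = y k * \<rho> - \<kappa> * h * r"
        unfolding u_def by (subst (2) \<rho>(3)[symmetric]) (simp add: algebra_simps)
      have 2: "y (Suc k) = y k * \<rho> + h * (x k * \<rho>) + \<sigma>\<^sup>2 * h\<^sup>2 / 2"
        and 3: "x (Suc k) = x k * \<rho> + \<sigma>\<^sup>2 * h"
        by (simp_all add: y_Suc x_Suc \<rho>_def)
      show ?thesis unfolding 1 unfolding u_def 2 3
        by (simp add: algebra_simps power2_eq_square)
    qed
    ultimately have "u k + \<sigma>\<^sup>2 * h\<^sup>2 / 4 \<le> u (Suc k)"
      by (simp add: algebra_simps)
    then show ?case using Suc by (simp add: field_simps)
  qed simp
  from this[of n] start neg[of n] show False by (simp add: u_def)
qed

end

text \<open>\<open>w\<close> stands for the power of \<open>h\<close> with exponent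
  \<open>p\<close>; in the form \<open>0 \<le> w \<le> 1\<close> all exponents are treated at once,
  with \<open>w = 0\<close> for \<open>p = \<infinity>\<close>. \<open>K\<^sub>1\<close> bounds
  single entries, in place of the norm bound with \<open>K\<^sub>0\<close>.\<close>

locale small_trajectory = trajectory h \<sigma> "K\<^sub>R * w" P for h \<sigma> K\<^sub>R w P +
  fixes K\<^sub>1 :: real
  assumes h_le_1: "h \<le> 1" and K\<^sub>R: "0 < K\<^sub>R" and w: "0 \<le> w" "w \<le> 1" and K\<^sub>1: "0 < K\<^sub>1"
    and P_1_1: "P $ 1 $ 1 \<le> K\<^sub>1 * h" and P_0_1: "\<bar>P $ 0 $ 1\<bar> \<le> K\<^sub>1 * h\<^sup>2"
begin

lemma x_0_le: "x 0 \<le> (K\<^sub>1 + \<sigma>\<^sup>2) * h"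
  using P_1_1 by (simp add: x_0 algebra_simps)

lemma sqrt_le_1: "sqrt (h * w) \<le> 1"
  using h h_le_1 w by (simp add: mult_le_one)

lemma pred_cov_1_1_upper:
  "x n \<le> (K\<^sub>1 + 2 * \<sigma>\<^sup>2 + sqrt (\<sigma>\<^sup>2 * K\<^sub>R)) * max h (sqrt (h * w))"
proof -
  define m where "m = max h (sqrt (h * w))"
  have "x n \<le> (K\<^sub>1 + 2 * \<sigma>\<^sup>2) * h + sqrt (\<sigma>\<^sup>2 * K\<^sub>R) * sqrt (h * w)"
    using x_le[of n] x_0_le by (simp add: algebra_simps real_sqrt_mult)
  also have "\<dots> \<le> (K\<^sub>1 + 2 * \<sigma>\<^sup>2) * m + sqrt (\<sigma>\<^sup>2 * K\<^sub>R) * m"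
    using K\<^sub>1 K\<^sub>R by (intro add_mono mult_left_mono) (auto simp: m_def)
  finally show ?thesis by (simp add: m_def algebra_simps)
qed

lemma cov_1_1_upper:
  "cov h \<sigma> (K\<^sub>R * w) P (Suc n) $ 1 $ 1 \<le>
    (K\<^sub>1 + 2 * \<sigma>\<^sup>2 + sqrt (\<sigma>\<^sup>2 * K\<^sub>R) + K\<^sub>R) * min w (sqrt (h * w))"
proof -
  define a where "a = cov h \<sigma> (K\<^sub>R * w) P (Suc n) $ 1 $ 1"
  define C where "C = K\<^sub>1 + 2 * \<sigma>\<^sup>2 + sqrt (\<sigma>\<^sup>2 * K\<^sub>R)"
  have C: "0 \<le> C" using K\<^sub>1 K\<^sub>R by (simp add: C_def)
  have "x n * (K\<^sub>R * w) / (x n + K\<^sub>R * w) \<le> K\<^sub>R * w" "x n * (K\<^sub>R * w) / (x n + K\<^sub>R * w) \<le> x n"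
    using x_pos[of n] xr_pos[of n] r mult_nonneg_nonneg[OF r r]
    by (simp_all add: pos_divide_le_eq algebra_simps)
  then have a: "a \<le> K\<^sub>R * w" "a \<le> x n" by (simp_all only: a_def cov_Suc_1_1)
  have "a \<le> (C + K\<^sub>R) * sqrt (h * w)"
  \<comment> \<open>For \<open>w \<le> h\<close> the bound through \<open>x n\<close> has only order
    \<open>h\<close>, which can exceed \<open>sqrt (h * w)\<close>, but \<open>w\<close> does not;
    for \<open>w > h\<close> the maximum in \<open>pred_cov_1_1_upper\<close> is
    \<open>sqrt (h * w)\<close>.\<close>
  proof (cases "w \<le> h")
    case True
    then have "w * w \<le> h * w" using w by (intro mult_right_mono) auto
    then have "w \<le> sqrt (h * w)" by (simp add: real_le_rsqrt power2_eq_square)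
    then have "K\<^sub>R * w \<le> (C + K\<^sub>R) * sqrt (h * w)"
      using K\<^sub>R C w by (intro mult_mono) auto
    then show ?thesis using a by simp
  next
    case False
    then have "h * h \<le> h * w" using h by (intro mult_left_mono) auto
    then have "h \<le> sqrt (h * w)" by (simp add: real_le_rsqrt power2_eq_square)
    then have "a \<le> C * sqrt (h * w)"
      using pred_cov_1_1_upper[of n] a by (simp add: C_def)
    also have "\<dots> \<le> (C + K\<^sub>R) * sqrt (h * w)"
      using K\<^sub>R h w by (intro mult_right_mono) auto
    finally show ?thesis .
  qed
  moreover have "a \<le> (C + K\<^sub>R) * w"
    using a C w mult_right_mono[of K\<^sub>R "C + K\<^sub>R" w] by simp
  ultimately show ?thesis by (simp add: a_def C_def min_def)
qed

lemma gain_0_upper: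
  "\<bar>gain (K\<^sub>R * w) 0 (pred_cov h \<sigma> (K\<^sub>R * w) P (Suc n))\<bar> \<le> (2 + 2 * K\<^sub>1 / \<sigma>\<^sup>2) * h"
proof -
  \<comment> \<open>Chosen so that
    \<open>K * \<sigma>\<^sup>2 = 2 * K\<^sub>1 + 2 * \<sigma>\<^sup>2\<close>: then
    \<open>x 0 \<ge> \<sigma>\<^sup>2 * h\<close> alone yields the start of \<open>abs_y_le\<close>,
    uniformly in \<open>w\<close>.\<close>
  define K where "K = 2 + 2 * K\<^sub>1 / \<sigma>\<^sup>2"
  have K: "1 \<le> K" using K\<^sub>1 by (simp add: K_def)
  have "h * P $ 1 $ 1 \<le> h * (K\<^sub>1 * h)" using P_1_1 h by (intro mult_left_mono) auto
  moreover have "0 \<le> h * P $ 1 $ 1" "0 \<le> \<sigma>\<^sup>2 * h\<^sup>2" using P h by auto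
  ultimately have "\<bar>y 0\<bar> \<le> K\<^sub>1 * h\<^sup>2 + h * (K\<^sub>1 * h) + \<sigma>\<^sup>2 * h\<^sup>2 / 2"
    using P_0_1 unfolding y_0 by linarith
  also have "\<dots> \<le> (2 * K\<^sub>1 + 2 * \<sigma>\<^sup>2) * h\<^sup>2"
    using \<open>0 \<le> \<sigma>\<^sup>2 * h\<^sup>2\<close> by (simp add: algebra_simps power2_eq_square)
  also have "\<dots> = K * h * (\<sigma>\<^sup>2 * h)"
    using \<sigma> by (simp add: K_def field_simps power2_eq_square)
  also have "\<dots> \<le> K * h * (x 0 + K\<^sub>R * w)"
    using K h r x_ge[of 0] by (intro mult_left_mono) auto
  finally have "\<bar>y n\<bar> \<le> K * h * (x n + K\<^sub>R * w)" by (rule abs_y_le[OF K])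
  then show ?thesis using xr_pos[of n] by (simp add: gain_0 K_def pos_divide_le_eq)
qed

text \<open>Transfers the upper and the lower order of the gain to P_01, at the cost of one factor
  \<open>R\<close>.\<close>

lemma cov_0_1_gain:
  "cov h \<sigma> (K\<^sub>R * w) P (Suc n) $ 0 $ 1 =
    K\<^sub>R * w * gain (K\<^sub>R * w) 0 (pred_cov h \<sigma> (K\<^sub>R * w) P (Suc n))"
  by (simp only: cov_Suc_0_1 gain_0) simp

lemma cov_0_1_upper:
  "\<bar>cov h \<sigma> (K\<^sub>R * w) P (Suc n) $ 0 $ 1\<bar> \<le> K\<^sub>R * (2 + 2 * K\<^sub>1 / \<sigma>\<^sup>2) * (h * w)"
proof -
  have "\<bar>cov h \<sigma> (K\<^sub>R * w) P (Suc n) $ 0 $ 1\<bar> =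
      K\<^sub>R * w * \<bar>gain (K\<^sub>R * w) 0 (pred_cov h \<sigma> (K\<^sub>R * w) P (Suc n))\<bar>"
    unfolding cov_0_1_gain using K\<^sub>R w by (simp add: abs_mult)
  also have "\<dots> \<le> K\<^sub>R * w * ((2 + 2 * K\<^sub>1 / \<sigma>\<^sup>2) * h)"
    using gain_0_upper r by (intro mult_left_mono) auto
  finally show ?thesis by (simp add: mult_ac)
qed

lemma gain_1_upper:
  "\<bar>1 - gain (K\<^sub>R * w) 1 (pred_cov h \<sigma> (K\<^sub>R * w) P (Suc n))\<bar> \<le> (1 + K\<^sub>R / \<sigma>\<^sup>2) * min (w / h) 1"
proof -
  define g where "g = K\<^sub>R * w / (x n + K\<^sub>R * w)"
  have g: "0 \<le> g" "g \<le> 1" using x_pos[of n] xr_pos[of n] r by (auto simp: g_def)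
  have "g \<le> K\<^sub>R * w / (\<sigma>\<^sup>2 * h)"
    unfolding g_def using x_ge[of n] noise_pos r by (intro divide_left_mono) auto
  also have "\<dots> = K\<^sub>R / \<sigma>\<^sup>2 * (w / h)" by simp
  also have "\<dots> \<le> (1 + K\<^sub>R / \<sigma>\<^sup>2) * (w / h)"
    using w h by (intro mult_right_mono) auto
  finally have "g \<le> (1 + K\<^sub>R / \<sigma>\<^sup>2) * (w / h)" .
  moreover have "g \<le> (1 + K\<^sub>R / \<sigma>\<^sup>2) * 1" using g K\<^sub>R by (simp add: add_increasing2)
  ultimately show ?thesis unfolding gain_1 g_def[symmetric] using g by (simp add: min_def)
qed

text \<open>The constant depends on the elapsed time \<open>real (Suc n) * h\<close>; at the last
  step this is \<open>T\<close>, and the constant no longer depends on \<open>h\<close>.\<close>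

lemma pred_cov_1_1_lower:
  "min (\<sigma>\<^sup>2) (min (sqrt (\<sigma>\<^sup>2 * K\<^sub>R / 2)) (\<sigma>\<^sup>2 * (real (Suc n) * h) / 2)) * max h (sqrt (h * w)) \<le> x n"
  (is "?c * _ \<le> _")
proof -
  have c: "0 \<le> ?c" using K\<^sub>R h by simp
  have "?c * h \<le> \<sigma>\<^sup>2 * h" using h by (intro mult_right_mono) auto
  then have 1: "?c * h \<le> x n" using x_ge[of n] by linarith
  have 2: "?c * sqrt (h * w) \<le> x n"
  proof (cases "sqrt (\<sigma>\<^sup>2 * h * (K\<^sub>R * w) / 2) \<le> x n")
    case True
    have "?c * sqrt (h * w) \<le> sqrt (\<sigma>\<^sup>2 * K\<^sub>R / 2) * sqrt (h * w)"
      using h w by (intro mult_right_mono) auto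
    also have "\<dots> = sqrt (\<sigma>\<^sup>2 * h * (K\<^sub>R * w) / 2)"
      by (simp add: real_sqrt_mult[symmetric] mult_ac)
    finally show ?thesis using True by simp
  next
    case False
    \<comment> \<open>The threshold is not reached yet, so \<open>x n\<close> is at least a multiple
      of the elapsed time; \<open>sqrt (h * w) \<le> 1\<close> makes this enough.\<close>
    then have "real (Suc n) * (\<sigma>\<^sup>2 * h / 2) \<le> x n" using x_growth[of n] by linarith
    moreover have "?c * sqrt (h * w) \<le> ?c * 1"
      using sqrt_le_1 c by (intro mult_left_mono)
    moreover have "?c \<le> \<sigma>\<^sup>2 * (real (Suc n) * h) / 2" by simp
    ultimately show ?thesis by (simp add: mult_ac)
  qed
  show ?thesis using 1 2 by (simp add: max_def)
qed

lemma cov_1_1_lower: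
  assumes c: "0 < c" and x: "c * max h (sqrt (h * w)) \<le> x n"
  shows "min c K\<^sub>R / 2 * min w (sqrt (h * w)) \<le> cov h \<sigma> (K\<^sub>R * w) P (Suc n) $ 1 $ 1"
proof -
  have hw: "0 \<le> sqrt (h * w)" using h w by simp
  have "min c K\<^sub>R * min w (sqrt (h * w)) \<le> c * max h (sqrt (h * w))"
    using c K\<^sub>R hw w by (intro mult_mono) auto
  moreover have "min c K\<^sub>R * min w (sqrt (h * w)) \<le> K\<^sub>R * w"
    using c K\<^sub>R hw w by (intro mult_mono) auto
  ultimately have "min c K\<^sub>R * min w (sqrt (h * w)) / 2 \<le> min (x n) (K\<^sub>R * w) / 2"
    using x by simp
  also have "\<dots> \<le> x n * (K\<^sub>R * w) / (x n + K\<^sub>R * w)"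
    by (rule harmonic_ge_half_min[OF x_pos r])
  finally show ?thesis unfolding cov_Suc_1_1 by simp
qed

text \<open>The first step suffices: \<open>x 0\<close> still has order \<open>h\<close>, so
  \<open>x 0 + K\<^sub>R * w\<close> is at most of order \<open>max h w\<close>, and
  \<open>w / max h w = min (w / h) 1\<close>.\<close>

lemma gain_1_lower:
  "K\<^sub>R / (K\<^sub>1 + \<sigma>\<^sup>2 + K\<^sub>R) * min (w / h) 1 \<le>
    1 - gain (K\<^sub>R * w) 1 (pred_cov h \<sigma> (K\<^sub>R * w) P (Suc 0))"
proof -
  define D where "D = K\<^sub>1 + \<sigma>\<^sup>2 + K\<^sub>R"
  have D: "0 < D" using K\<^sub>1 K\<^sub>R by (simp add: D_def add_pos_nonneg)
  define m where "m = max h w"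
  have m: "0 < m" using h by (simp add: m_def)
  have "x 0 + K\<^sub>R * w \<le> (K\<^sub>1 + \<sigma>\<^sup>2) * h + K\<^sub>R * w" using x_0_le by simp
  also have "\<dots> \<le> (K\<^sub>1 + \<sigma>\<^sup>2) * m + K\<^sub>R * m"
    using K\<^sub>1 K\<^sub>R by (intro add_mono mult_left_mono) (auto simp: m_def)
  finally have "x 0 + K\<^sub>R * w \<le> D * m" by (simp add: D_def algebra_simps)
  then have "K\<^sub>R * w / (D * m) \<le> K\<^sub>R * w / (x 0 + K\<^sub>R * w)"
    using xr_pos[of 0] D m r by (intro divide_left_mono) auto
  moreover have "min (w / h) 1 = w / m"
    using h w by (auto simp: m_def min_def max_def field_simps)
  ultimately show ?thesis by (simp add: gain_1 D_def)
qed

lemma gain_0_lower: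
  fixes N :: nat and T :: real
  assumes N: "real N * h = T" "1 \<le> N" and T: "0 < T"
    and h_small: "h \<le> \<sigma>\<^sup>2 * T / (16 * (K\<^sub>1 + \<sigma>\<^sup>2))"
  shows "\<exists>n\<in>{1..N}. min (1 / 4) (\<sigma>\<^sup>2 * T / (16 * K\<^sub>R)) * h \<le>
    gain (K\<^sub>R * w) 0 (pred_cov h \<sigma> (K\<^sub>R * w) P n)"
proof -
  \<comment> \<open>\<open>1 / 4\<close> is the limit set by \<open>ex_y_gt\<close>; the other term
    makes \<open>\<kappa> * (K\<^sub>R * w)\<close> at most \<open>\<sigma>\<^sup>2 * T / 16\<close>
    for every \<open>w \<le> 1\<close>.\<close>
  define \<kappa> where "\<kappa> = min (1 / 4) (\<sigma>\<^sup>2 * T / (16 * K\<^sub>R))"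
  have \<kappa>: "0 < \<kappa>" "\<kappa> \<le> 1 / 4" "\<kappa> * K\<^sub>R \<le> \<sigma>\<^sup>2 * T / 16"
  proof -
    show "0 < \<kappa>" "\<kappa> \<le> 1 / 4" using T K\<^sub>R \<sigma> by (auto simp: \<kappa>_def)
    have "\<kappa> * K\<^sub>R \<le> \<sigma>\<^sup>2 * T / (16 * K\<^sub>R) * K\<^sub>R" using K\<^sub>R by (intro mult_right_mono) (auto simp: \<kappa>_def)
    then show "\<kappa> * K\<^sub>R \<le> \<sigma>\<^sup>2 * T / 16" using K\<^sub>R by simp
  qed
  have "h * (16 * (K\<^sub>1 + \<sigma>\<^sup>2)) \<le> \<sigma>\<^sup>2 * T"
    using h_small K\<^sub>1 \<sigma> by (simp add: pos_le_divide_eq add_pos_pos)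
  then have hs: "(K\<^sub>1 + \<sigma>\<^sup>2) * h \<le> \<sigma>\<^sup>2 * T / 16" by (simp add: algebra_simps)
  have "\<kappa> * (K\<^sub>R * w) \<le> \<sigma>\<^sup>2 * T / 16"
    using \<kappa> w mult_mono[of "\<kappa> * K\<^sub>R" "\<sigma>\<^sup>2 * T / 16" w 1] T by (simp add: mult_ac)
  moreover have "\<kappa> * x 0 \<le> 1 / 4 * ((K\<^sub>1 + \<sigma>\<^sup>2) * h)"
    using \<kappa> x_0_le x_pos[of 0] by (intro mult_mono) auto
  ultimately have "\<kappa> * (x 0 + K\<^sub>R * w) \<le> \<sigma>\<^sup>2 * T / 64 + \<sigma>\<^sup>2 * T / 16"
    using hs by (simp add: algebra_simps)
  then have "\<kappa> * (x 0 + K\<^sub>R * w) * h \<le> (\<sigma>\<^sup>2 * T / 64 + \<sigma>\<^sup>2 * T / 16) * h"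
    using h by (intro mult_right_mono) auto
  moreover have "- y 0 \<le> K\<^sub>1 * h * h"
  proof -
    have "0 \<le> h * P $ 1 $ 1" "0 \<le> \<sigma>\<^sup>2 * h\<^sup>2" using P h by auto
    then show ?thesis using P_0_1 unfolding y_0 power2_eq_square by linarith
  qed
  \<comment> \<open>Smallness of \<open>h\<close> absorbs a possibly negative \<open>y 0\<close>
    together with the increment lost by having \<open>N - 1\<close> instead of \<open>N\<close>
    steps.\<close>
  moreover have "K\<^sub>1 * h * h + \<sigma>\<^sup>2 * h * h \<le> \<sigma>\<^sup>2 * T / 16 * h"
    using mult_right_mono[OF hs, of h] h by (simp add: algebra_simps)
  moreover have "0 < \<sigma>\<^sup>2 * T * h" "0 < \<sigma>\<^sup>2 * h * h" using \<sigma> T h by auto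
  \<comment> \<open>\<open>y k\<close> belongs to the step with number \<open>Suc k\<close>, so only
    \<open>N - 1\<close> increments are available up to time \<open>T\<close>.\<close>
  moreover have "real (N - 1) * (\<sigma>\<^sup>2 * h\<^sup>2 / 4) = \<sigma>\<^sup>2 * T * h / 4 - \<sigma>\<^sup>2 * h * h / 4"
  proof -
    have "real (N - 1) = real N - 1" using N(2) by simp
    then show ?thesis unfolding N(1)[symmetric] by (simp add: field_simps power2_eq_square)
  qed
  ultimately have "\<kappa> * h * (x 0 + K\<^sub>R * w) - y 0 < real (N - 1) * (\<sigma>\<^sup>2 * h\<^sup>2 / 4)"
    by (simp add: algebra_simps)
  then obtain k where k: "k \<le> N - 1" "\<kappa> * h * (x k + K\<^sub>R * w) < y k"
    using ex_y_gt[of \<kappa> "N - 1"] \<kappa> by auto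
  then have "\<kappa> * h \<le> y k / (x k + K\<^sub>R * w)" using xr_pos[of k] by (simp add: pos_le_divide_eq)
  then show ?thesis using k N unfolding \<kappa>_def[symmetric] gain_0[symmetric]
    by (intro bexI[of _ "Suc k"]) auto
qed

end

subsection \<open>Norms, powers and maxima over steps\<close>

text \<open>Equivalence with the maximum norm. Expansion in the standard basis gives the upper
  constant and makes \<open>nrm\<close> Lipschitz; the lower constant is its minimum on the compact
  Euclidean unit sphere.\<close>

lemma is_norm_bounds:
  fixes nrm :: "real ^ 'd::finite \<Rightarrow> real"
  assumes nrm: "is_norm nrm"
  obtains c D where "0 < c" "0 < D" "\<And>v j. c * \<bar>v $ j\<bar> \<le> nrm v"
    "\<And>v M. (\<And>j. \<bar>v $ j\<bar> \<le> M) \<Longrightarrow> nrm v \<le> D * M"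
proof -
  have nonneg: "0 \<le> nrm x" and zero: "nrm x = 0 \<longleftrightarrow> x = 0"
    and scale: "nrm (a *\<^sub>R x) = \<bar>a\<bar> * nrm x" and tri: "nrm (x + z) \<le> nrm x + nrm z" for a x z
    using nrm by (auto simp: is_norm_def)
  define D where "D = 1 + (\<Sum>j\<in>UNIV. nrm (axis j 1))"
  have D: "0 < D" unfolding D_def using nonneg by (intro add_pos_nonneg sum_nonneg) auto
  have sum_le: "nrm (sum f A) \<le> (\<Sum>a\<in>A. nrm (f a))" if "finite A" for f :: "'d \<Rightarrow> _" and A
    using that
  proof (induction A)
    case empty
    then show ?case using zero[of 0] by simp
  next
    case (insert a A)
    then show ?case using tri[of "f a" "sum f A"] by simp
  qed
  have upper: "nrm v \<le> D * M" if "\<And>j. \<bar>v $ j\<bar> \<le> M" for v M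
  proof -
    have M: "0 \<le> M" using that[of undefined] by linarith
    have "nrm v = nrm (\<Sum>j\<in>UNIV. v $ j *\<^sub>R axis j 1)"
      by (simp add: basis_expansion scalar_mult_eq_scaleR[symmetric])
    also have "\<dots> \<le> (\<Sum>j\<in>UNIV. \<bar>v $ j\<bar> * nrm (axis j 1))"
      using sum_le[of UNIV "\<lambda>j. v $ j *\<^sub>R axis j 1"] by (simp add: scale)
    also have "\<dots> \<le> (\<Sum>j\<in>UNIV. M * nrm (axis j 1))"
      using that nonneg by (intro sum_mono mult_right_mono) auto
    also have "\<dots> \<le> D * M" using M by (simp add: D_def sum_distrib_left algebra_simps)
    finally show ?thesis .
  qed
  have lip: "\<bar>nrm v - nrm z\<bar> \<le> D * norm (v - z)" for v z
  proof -
    have "nrm (v - z) \<le> D * norm (v - z)" by (intro upper component_le_norm_cart)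
    moreover have "nrm (z - v) = nrm (v - z)" using scale[of "-1" "v - z"] by simp
    ultimately show ?thesis using tri[of z "v - z"] tri[of v "z - v"] by simp
  qed
  have "continuous_on (sphere 0 1) nrm"
  proof (rule lipschitz_on_continuous_on[where L = D], rule lipschitz_onI)
    show "dist (nrm v) (nrm z) \<le> D * dist v z" for v z
      using lip[of v z] by (simp add: dist_norm)
  qed (use D in simp)
  moreover have "sphere (0 :: real ^ 'd) 1 \<noteq> {}" by simp
  ultimately obtain m where m: "norm m = 1" "\<And>v. norm v = 1 \<Longrightarrow> nrm m \<le> nrm v"
    using continuous_attains_inf[OF compact_sphere] by (metis mem_sphere_0)
  have c: "0 < nrm m" using m(1) nonneg[of m] zero[of m] by fastforce
  have "nrm m * \<bar>v $ j\<bar> \<le> nrm v" for v j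
  proof (cases "v = 0")
    case True
    then show ?thesis using nonneg by simp
  next
    case False
    then have "nrm m \<le> nrm ((1 / norm v) *\<^sub>R v)" by (intro m(2)) simp
    then have "nrm m * norm v \<le> nrm v" using False by (simp only: scale) (simp add: field_simps)
    moreover have "nrm m * \<bar>v $ j\<bar> \<le> nrm m * norm v"
      using c component_le_norm_cart by (intro mult_left_mono) auto
    ultimately show ?thesis by linarith
  qed
  from that[OF c D this upper] show thesis by blast
qed

section \<open>Powers of the step size with extended exponents\<close>

lemma hpow_ereal: "hpow h (ereal q) = h powr q"
  by (simp add: hpow_def)

lemma hpow_0: "0 < h \<Longrightarrow> hpow h 0 = 1"
  by (simp add: hpow_def)

lemma hpow_1: "0 < h \<Longrightarrow> hpow h 1 = h"
  by (simp add: hpow_def)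

lemma hpow_nonneg: "0 \<le> hpow h p"
  by (simp add: hpow_def)

text \<open>The exponent \<open>-\<infinity>\<close> has to be excluded:
  \<open>real_of_ereal\<close> sends it to 0, so \<open>hpow\<close> would give 1 there and not a
  large value.\<close>

lemma hpow_antimono:
  assumes "0 < h" "h \<le> 1" "p \<noteq> -\<infinity>" "p \<le> q"
  shows "hpow h q \<le> hpow h p"
proof (cases q)
  case (real b)
  then obtain a where "p = ereal a" using assms by (cases p) auto
  then show ?thesis using real assms by (simp add: hpow_ereal powr_mono')
qed (use assms hpow_nonneg in \<open>auto simp: hpow_def\<close>)

lemma hpow_min:
  assumes "0 < h" "h \<le> 1" "p \<noteq> -\<infinity>" "q \<noteq> -\<infinity>"
  shows "hpow h (min p q) = max (hpow h p) (hpow h q)"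
  using hpow_antimono[of h p q] hpow_antimono[of h q p] assms
  by (cases "p \<le> q") (auto simp: min_def max_def)

lemma hpow_max:
  assumes "0 < h" "h \<le> 1" "p \<noteq> -\<infinity>" "q \<noteq> -\<infinity>"
  shows "hpow h (max p q) = min (hpow h p) (hpow h q)"
  using hpow_antimono[of h p q] hpow_antimono[of h q p] assms
  by (cases "p \<le> q") (auto simp: min_def max_def)

lemma hpow_add_1:
  assumes "0 < h" "0 \<le> p"
  shows "hpow h (p + 1) = h * hpow h p"
  using assms by (cases p) (auto simp: hpow_def powr_add)

lemma hpow_diff_1:
  assumes "0 < h" "0 \<le> p"
  shows "hpow h (p - 1) = hpow h p / h"
  using assms by (cases p) (auto simp: hpow_def powr_diff one_ereal_def)

lemma hpow_half:
  assumes "0 < h"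
  shows "hpow h (p / 2) = sqrt (hpow h p)"
proof (cases p)
  case (real q)
  have "p / 2 = ereal (q / 2)" using real by (simp add: numeral_eq_ereal)
  then show ?thesis using real assms by (simp add: hpow_ereal powr_half_sqrt_powr)
qed (auto simp: hpow_def)

text \<open>The step sizes \<open>T / real (Suc n)\<close> accumulate at 0. On the trivial filter
  every order would hold vacuously and sharpness would be false.\<close>

lemma small_steps_neq_bot:
  assumes "0 < T"
  shows "small_steps T \<noteq> bot"
proof -
  have "0 islimpt {h. 0 < h \<and> T / h \<in> \<nat>}"
    unfolding islimpt_sequential
  proof (intro exI[of _ "\<lambda>n. T / real (Suc n)"] conjI allI)
    show "T / real (Suc n) \<in> {h. 0 < h \<and> T / h \<in> \<nat>} - {0}" for n
      using assms by simp
    show "(\<lambda>n. T / real (Suc n)) \<longlonglongrightarrow> 0"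
      using LIMSEQ_Suc[OF lim_const_over_n[of T]] by simp
  qed
  then show ?thesis by (simp add: small_steps_def trivial_limit_within)
qed

lemma eventually_small_steps:
  assumes "0 < b"
  shows "\<forall>\<^sub>F h in small_steps T. 0 < h \<and> h \<le> b \<and> T / h \<in> \<nat>"
  unfolding small_steps_def eventually_at using assms by (intro exI[of _ b]) (auto simp: dist_real_def)

text \<open>Comparing the lower bound with an upper bound of higher order gives
  \<open>c \<le> K * h powr (b - a)\<close> for arbitrarily small \<open>h\<close>, although the
  power tends to 0.\<close>

lemma order_sharp:
  assumes T: "0 < T" and c: "0 < c" and q: "0 \<le> q" "q < e"
    and lower: "\<forall>\<^sub>F h in small_steps T. c * hpow h q \<le> f h"
  shows "\<not> (\<exists>K>0. \<forall>\<^sub>F h in small_steps T. f h \<le> K * hpow h e)"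
proof
  assume "\<exists>K>0. \<forall>\<^sub>F h in small_steps T. f h \<le> K * hpow h e"
  then obtain K where K: "0 < K" and upper: "\<forall>\<^sub>F h in small_steps T. f h \<le> K * hpow h e" by blast
  obtain a where a: "q = ereal a" using q by (cases q) auto
  \<comment> \<open>\<open>e\<close> may be infinite, so a real exponent above \<open>a\<close> is
    interposed.\<close>
  obtain b where b: "a < b" "ereal b \<le> e"
    using ereal_dense2[OF q(2)] a by (metis ereal_less_eq(3) less_ereal.simps(1) less_imp_le)
  have "((\<lambda>h. h powr (b - a)) \<longlongrightarrow> 0 powr (b - a)) (small_steps T)"
    unfolding small_steps_def using b(1)
    by (intro tendsto_powr2 tendsto_ident_at tendsto_const) (auto simp: eventually_at_filter)
  then have "\<forall>\<^sub>F h in small_steps T. h powr (b - a) < c / K"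
    using c K b(1) by (intro order_tendstoD(2)[where y = "0 powr (b - a)"]) auto
  then have "\<forall>\<^sub>F h in small_steps T. False"
    using lower upper eventually_small_steps[OF zero_less_one]
  proof eventually_elim
    case (elim h)
    have "c * h powr a \<le> K * hpow h e" using elim by (simp add: a hpow_ereal)
    also have "\<dots> \<le> K * hpow h (ereal b)"
      using hpow_antimono[of h "ereal b" e] elim b K by (intro mult_left_mono) auto
    also have "\<dots> = K * h powr (b - a) * h powr a"
      using elim by (simp add: hpow_ereal powr_diff)
    finally have "c \<le> K * h powr (b - a)" using elim by simp
    then show False using elim(1) K by (simp add: field_simps)
  qed
  then show False using small_steps_neq_bot[OF T] by (simp add: eventually_False)
qed

text \<open>\<open>T / h\<close> is a positive natural number, so the index set is nonempty and
  \<open>Max\<close> is meaningful.\<close>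

lemma max_steps_le_iff:
  assumes "0 < T" "0 < h" "T / h \<in> \<nat>"
  shows "max_steps T h f \<le> M \<longleftrightarrow> (\<forall>n\<in>{1..nat \<lfloor>T / h\<rfloor>}. f n \<le> M)"
proof -
  obtain N where N: "T / h = real N" using assms(3) by (elim Nats_cases)
  then have "1 \<le> N" using assms by (cases N) auto
  then have "{1..nat \<lfloor>T / h\<rfloor>} \<noteq> {}" using N by simp
  then show ?thesis unfolding max_steps_def by (subst Max_le_iff) auto
qed

lemma le_max_steps: "n \<in> {1..nat \<lfloor>T / h\<rfloor>} \<Longrightarrow> L \<le> f n \<Longrightarrow> L \<le> max_steps T h f"
  unfolding max_steps_def by (intro Max_ge_iff[THEN iffD2]) auto

subsection \<open>Orders in all coordinates\<close>

text \<open>The orders of the claim written in \<open>h\<close> and \<open>w\<close>: for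
  \<open>h \<le> 1\<close> a minimum of exponents is a maximum of powers and conversely, and
  exponent \<open>(p + 1) / 2\<close> becomes \<open>sqrt (h * w)\<close>.\<close>

definition upper_orders where
  "upper_orders K h \<sigma> K\<^sub>R w P n \<longleftrightarrow>
     pred_cov h \<sigma> (K\<^sub>R * w) P n $ 1 $ 1 \<le> K * max h (sqrt (h * w)) \<and>
     cov h \<sigma> (K\<^sub>R * w) P n $ 1 $ 1 \<le> K * min w (sqrt (h * w)) \<and>
     \<bar>cov h \<sigma> (K\<^sub>R * w) P n $ 0 $ 1\<bar> \<le> K * (h * w) \<and>
     \<bar>gain (K\<^sub>R * w) 0 (pred_cov h \<sigma> (K\<^sub>R * w) P n)\<bar> \<le> K * h \<and>
     \<bar>1 - gain (K\<^sub>R * w) 1 (pred_cov h \<sigma> (K\<^sub>R * w) P n)\<bar> \<le> K * min (w / h) 1"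

text \<open>The step that attains the order may differ from quantity to quantity. The bounds are
  signed, so they also bound absolute values from below.\<close>

definition lower_orders where
  "lower_orders c h \<sigma> K\<^sub>R w P N \<longleftrightarrow>
     (\<exists>n\<in>{1..N}. c * max h (sqrt (h * w)) \<le> pred_cov h \<sigma> (K\<^sub>R * w) P n $ 1 $ 1) \<and>
     (\<exists>n\<in>{1..N}. c * min w (sqrt (h * w)) \<le> cov h \<sigma> (K\<^sub>R * w) P n $ 1 $ 1) \<and>
     (\<exists>n\<in>{1..N}. c * (h * w) \<le> cov h \<sigma> (K\<^sub>R * w) P n $ 0 $ 1) \<and>
     (\<exists>n\<in>{1..N}. c * h \<le> gain (K\<^sub>R * w) 0 (pred_cov h \<sigma> (K\<^sub>R * w) P n)) \<and>
     (\<exists>n\<in>{1..N}. c * min (w / h) 1 \<le> 1 - gain (K\<^sub>R * w) 1 (pred_cov h \<sigma> (K\<^sub>R * w) P n))"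

text \<open>The point is the order of quantifiers: \<open>K\<close> is fixed before
  \<open>h\<close>, \<open>w\<close>, \<open>P\<close> and \<open>n\<close>. The sum of all
  constants involved dominates each of them.\<close>

lemma ex_upper_orders:
  assumes "0 < \<sigma>" "0 < K\<^sub>R" "0 < K\<^sub>1"
  shows "\<exists>K>0. \<forall>h w P n. small_trajectory h \<sigma> K\<^sub>R w P K\<^sub>1 \<longrightarrow> 1 \<le> n \<longrightarrow> upper_orders K h \<sigma> K\<^sub>R w P n"
proof -
  define C where "C = K\<^sub>1 + 2 * \<sigma>\<^sup>2 + sqrt (\<sigma>\<^sup>2 * K\<^sub>R)"
  define G where "G = 2 + 2 * K\<^sub>1 / \<sigma>\<^sup>2"
  define H where "H = 1 + K\<^sub>R / \<sigma>\<^sup>2"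
  define K where "K = C + K\<^sub>R + G + K\<^sub>R * G + H"
  have pos: "0 < C" "0 < G" "0 < H" "0 < K\<^sub>R * G"
    using assms by (auto simp: C_def G_def H_def add_pos_nonneg)
  then have K: "0 < K" "C \<le> K" "C + K\<^sub>R \<le> K" "G \<le> K" "K\<^sub>R * G \<le> K" "H \<le> K"
    using assms unfolding K_def by linarith+
  have "upper_orders K h \<sigma> K\<^sub>R w P n" if t: "small_trajectory h \<sigma> K\<^sub>R w P K\<^sub>1" and "1 \<le> n" for h w P n
  proof -
    interpret small_trajectory h \<sigma> K\<^sub>R w P K\<^sub>1 by fact
    obtain m where n: "n = Suc m" using \<open>1 \<le> n\<close> by (cases n) auto
    have weaken: "L \<le> K * b" if "L \<le> k * b" "k \<le> K" "0 \<le> b" for L k b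
      using that mult_right_mono[of k K b] by linarith
    have hw: "0 \<le> sqrt (h * w)" "0 \<le> h" "0 \<le> h * w" "0 \<le> w / h" using h w by auto
    show ?thesis unfolding upper_orders_def n
      using weaken[OF pred_cov_1_1_upper[of m, folded C_def] K(2)]
        weaken[OF cov_1_1_upper[of m, folded C_def] K(3)]
        weaken[OF cov_0_1_upper[of m, folded G_def] K(5)]
        weaken[OF gain_0_upper[of m, folded G_def] K(4)]
        weaken[OF gain_1_upper[of m, folded H_def] K(6)] hw w
      by (simp add: x_def)
  qed
  then show ?thesis using K(1) by blast
qed

text \<open>Both P_11 bounds are attained at the last step \<open>N\<close>, the one for the gain
  with index 1 at step 1, and those for P_01 and the gain with index 0 at a common step provided by
  \<open>gain_0_lower\<close>.\<close>

lemma ex_lower_orders: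
  fixes T :: real
  assumes "0 < \<sigma>" "0 < K\<^sub>R" "0 < K\<^sub>1" "0 < T"
  shows "\<exists>c>0. \<exists>b>0. \<forall>h w P N. small_trajectory h \<sigma> K\<^sub>R w P K\<^sub>1 \<longrightarrow> h \<le> b \<longrightarrow>
    real N * h = T \<longrightarrow> 1 \<le> N \<longrightarrow> lower_orders c h \<sigma> K\<^sub>R w P N"
proof -
  define k where "k = min (\<sigma>\<^sup>2) (min (sqrt (\<sigma>\<^sup>2 * K\<^sub>R / 2)) (\<sigma>\<^sup>2 * T / 2))"
  define \<kappa> where "\<kappa> = min (1 / 4) (\<sigma>\<^sup>2 * T / (16 * K\<^sub>R))"
  define H where "H = K\<^sub>R / (K\<^sub>1 + \<sigma>\<^sup>2 + K\<^sub>R)"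
  define b where "b = \<sigma>\<^sup>2 * T / (16 * (K\<^sub>1 + \<sigma>\<^sup>2))"
  define c where "c = min k (min (min k K\<^sub>R / 2) (min \<kappa> (min (K\<^sub>R * \<kappa>) H)))"
  have pos: "0 < k" "0 < \<kappa>" "0 < H" "0 < b"
    using assms by (auto simp: k_def \<kappa>_def H_def b_def add_pos_nonneg)
  then have c: "0 < c" "c \<le> k" "c \<le> min k K\<^sub>R / 2" "c \<le> \<kappa>" "c \<le> K\<^sub>R * \<kappa>" "c \<le> H"
    using assms unfolding c_def by auto
  have "lower_orders c h \<sigma> K\<^sub>R w P N"
    if t: "small_trajectory h \<sigma> K\<^sub>R w P K\<^sub>1" and hb: "h \<le> b" and N: "real N * h = T" "1 \<le> N" for h w P N
  proof -
    interpret small_trajectory h \<sigma> K\<^sub>R w P K\<^sub>1 by fact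
    obtain m where m: "N = Suc m" using N by (cases N) auto
    have weaken: "c * b \<le> L" if "k * b \<le> L" "c \<le> k" "0 \<le> b" for L k b
      using that mult_right_mono[of c k b] by linarith
    have hw: "0 \<le> sqrt (h * w)" "0 \<le> h" "0 \<le> h * w" "0 \<le> w / h" using h w by auto
    have x: "k * max h (sqrt (h * w)) \<le> x m"
      using pred_cov_1_1_lower[of m] unfolding m[symmetric] N(1) k_def[symmetric] .
    obtain n where n: "n \<in> {1..N}" "\<kappa> * h \<le> gain (K\<^sub>R * w) 0 (pred_cov h \<sigma> (K\<^sub>R * w) P n)"
      using gain_0_lower[OF N assms(4) hb[unfolded b_def]] unfolding \<kappa>_def by blast
    then obtain i where i: "n = Suc i" by (cases n) auto
    have "K\<^sub>R * w * (\<kappa> * h) \<le> cov h \<sigma> (K\<^sub>R * w) P n $ 0 $ 1"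
      using n r unfolding i cov_0_1_gain by (intro mult_left_mono) auto
    then have "K\<^sub>R * \<kappa> * (h * w) \<le> cov h \<sigma> (K\<^sub>R * w) P n $ 0 $ 1" by (simp add: mult_ac)
    then have "c * (h * w) \<le> cov h \<sigma> (K\<^sub>R * w) P n $ 0 $ 1"
      and "c * h \<le> gain (K\<^sub>R * w) 0 (pred_cov h \<sigma> (K\<^sub>R * w) P n)"
      using weaken c hw n by blast+
    moreover have "c * max h (sqrt (h * w)) \<le> pred_cov h \<sigma> (K\<^sub>R * w) P N $ 1 $ 1"
      using weaken[OF x c(2)] hw by (simp add: x_def m)
    moreover have "c * min w (sqrt (h * w)) \<le> cov h \<sigma> (K\<^sub>R * w) P N $ 1 $ 1"
      using weaken[OF cov_1_1_lower[OF pos(1) x] c(3)] hw w by (simp only: m)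
    moreover have "c * min (w / h) 1 \<le> 1 - gain (K\<^sub>R * w) 1 (pred_cov h \<sigma> (K\<^sub>R * w) P 1)"
      using weaken[OF gain_1_lower[folded H_def] c(6)] hw by simp
    moreover have "N \<in> {1..N}" "1 \<in> {1..N}" using N by auto
    ultimately show ?thesis using n(1) unfolding lower_orders_def by blast
  qed
  then show ?thesis using c(1) pos(4) by blast
qed

section \<open>From single coordinates to norms and maxima over steps\<close>

theorem proposition10:
  fixes \<sigma> :: "'d::finite \<Rightarrow> real" and nrm :: "real ^ 'd \<Rightarrow> real"
    and p :: ereal and K\<^sub>R :: real and R :: "real \<Rightarrow> real"
  assumes \<sigma>: "\<And>j. 0 < \<sigma> j" and nrm: "is_norm nrm"
    and p: "0 \<le> p" and K\<^sub>R: "0 < K\<^sub>R" and R: "\<And>h. R h = K\<^sub>R * hpow h p"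
  shows
    "(\<forall>h>0. \<forall>j.
        let s = \<sigma> j; r = R h; S = sqrt (4 * s\<^sup>2 * r * h + s ^ 4 * h\<^sup>2);
            C = cov h s r; C\<^sub>m = pred_cov h s r; F = cov_step h s r; F\<^sub>m = pred_step h s r
        in unique_attractive_steady_state C\<^sub>m F\<^sub>m {1} (\<lambda>P. P $ 1 $ 1)
             ((s\<^sup>2 * h + S) / 2)
         \<and> unique_attractive_steady_state C F {1} (\<lambda>P. P $ 1 $ 1)
             ((s\<^sup>2 * h + S) * r / (s\<^sup>2 * h + S + 2 * r))
         \<and> unique_attractive_steady_state C\<^sub>m F\<^sub>m UNIV (\<lambda>P. P $ 0 $ 1)
             ((s ^ 4 * h\<^sup>2 + (2 * r + s\<^sup>2 * h) * S + 4 * r * s\<^sup>2 * h) / (2 * (s\<^sup>2 * h + S)) * h)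
         \<and> unique_attractive_steady_state C F UNIV (\<lambda>P. P $ 0 $ 1)
             (r * S / (s\<^sup>2 * h + S) * h)
         \<and> unique_attractive_steady_state C\<^sub>m F\<^sub>m UNIV (gain r 0)
             (S / (s\<^sup>2 * h + S) * h)
         \<and> unique_attractive_steady_state C\<^sub>m F\<^sub>m {1} (gain r 1)
             ((s\<^sup>2 * h + S) / (s\<^sup>2 * h + S + 2 * r)))
     \<and>
     (\<forall>(T::real) (K\<^sub>0::real) (P\<^sub>0 :: real \<Rightarrow> 'd \<Rightarrow> real ^ 2 ^ 2).
        0 < T \<longrightarrow> 0 < K\<^sub>0 \<longrightarrow> (\<forall>h>0. \<forall>j. is_cov (P\<^sub>0 h j)) \<longrightarrow>
        (\<forall>\<^sub>F h in small_steps T. \<forall>k\<in>{0, 1::nat}. \<forall>l\<in>{0, 1::nat}.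
           nrm (\<chi> j. P\<^sub>0 h j $ of_nat k $ of_nat l) \<le> K\<^sub>0 * h ^ (3 - k - l)) \<longrightarrow>
        (let P = (\<lambda>h. cov_vec h \<sigma> (R h) (P\<^sub>0 h)); P\<^sub>m = (\<lambda>h. pred_cov_vec h \<sigma> (R h) (P\<^sub>0 h));
             \<beta> = (\<lambda>h. gain_vec h \<sigma> (R h) (P\<^sub>0 h))
         in (\<exists>K>0. \<forall>\<^sub>F h in small_steps T.
               (\<forall>j. max_steps T h (\<lambda>n. P\<^sub>m h n 1 1 $ j) \<le> K * hpow h (min 1 ((p + 1) / 2)))
             \<and> (\<forall>j. max_steps T h (\<lambda>n. P h n 1 1 $ j) \<le> K * hpow h (max p ((p + 1) / 2)))
             \<and> max_steps T h (\<lambda>n. nrm (P h n 0 1)) \<le> K * hpow h (p + 1)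
             \<and> max_steps T h (\<lambda>n. nrm (\<beta> h n 0)) \<le> K * hpow h 1
             \<and> max_steps T h (\<lambda>n. nrm (1 - \<beta> h n 1)) \<le> K * hpow h (max (p - 1) 0))
          \<and> (\<forall>e > min 1 ((p + 1) / 2). \<forall>j. \<not> (\<exists>K>0. \<forall>\<^sub>F h in small_steps T.
               max_steps T h (\<lambda>n. P\<^sub>m h n 1 1 $ j) \<le> K * hpow h e))
          \<and> (\<forall>e > max p ((p + 1) / 2). \<forall>j. \<not> (\<exists>K>0. \<forall>\<^sub>F h in small_steps T.
               max_steps T h (\<lambda>n. P h n 1 1 $ j) \<le> K * hpow h e))
          \<and> (\<forall>e > p + 1. \<not> (\<exists>K>0. \<forall>\<^sub>F h in small_steps T.
               max_steps T h (\<lambda>n. nrm (P h n 0 1)) \<le> K * hpow h e))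
          \<and> (\<forall>e > 1. \<not> (\<exists>K>0. \<forall>\<^sub>F h in small_steps T.
               max_steps T h (\<lambda>n. nrm (\<beta> h n 0)) \<le> K * hpow h e))
          \<and> (\<forall>e > max (p - 1) 0. \<not> (\<exists>K>0. \<forall>\<^sub>F h in small_steps T.
               max_steps T h (\<lambda>n. nrm (1 - \<beta> h n 1)) \<le> K * hpow h e))))"
proof (intro conjI, goal_cases steady orders)
  case steady
  show ?case
  proof (intro allI impI, goal_cases)
    case h: (1 h j)
    have "0 \<le> R h" using K\<^sub>R hpow_nonneg[of h p] by (simp add: R)
    then interpret coordinate h "\<sigma> j" "R h" using h \<sigma> by unfold_locales
    show ?case using steady_states unfolding S_def Let_def by blast
  qed
next
  case orders
  show ?case
  proof (intro allI impI, goal_cases)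
    case (1 T K\<^sub>0 P\<^sub>0)
    note T = 1(1) and K\<^sub>0 = 1(2) and cov = 1(3) and init = 1(4)
    obtain c D where c: "0 < c" and D: "0 < D" and nrm_lower: "\<And>v j. c * \<bar>v $ j\<bar> \<le> nrm v"
      and nrm_upper: "\<And>v M. (\<And>j. \<bar>v $ j\<bar> \<le> M) \<Longrightarrow> nrm v \<le> D * M"
      using is_norm_bounds[OF nrm] by metis
    \<comment> \<open>Dividing by the lower norm constant turns the bound on the norm into a bound
      on every coordinate.\<close>
    define K\<^sub>1 where "K\<^sub>1 = K\<^sub>0 / c"
    have K\<^sub>1: "0 < K\<^sub>1" using K\<^sub>0 c by (simp add: K\<^sub>1_def)
    define w where "w h = hpow h p" for h
    have small: "\<forall>\<^sub>F h in small_steps T. 0 < h \<and> h \<le> 1 \<and> T / h \<in> \<nat> \<and>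
        (\<forall>j. small_trajectory h (\<sigma> j) K\<^sub>R (w h) (P\<^sub>0 h j) K\<^sub>1)"
      using init eventually_small_steps[OF zero_less_one]
    proof eventually_elim
      case (elim h)
      \<comment> \<open>The column index is 1, so the exponent \<open>3 - k - l\<close> reads
        \<open>2 - k\<close>.\<close>
      have entry: "\<bar>P\<^sub>0 h j $ of_nat k $ 1\<bar> \<le> K\<^sub>1 * h ^ (2 - k)" if "k \<in> {0, 1}" for j and k :: nat
      proof -
        have "c * \<bar>P\<^sub>0 h j $ of_nat k $ 1\<bar> \<le> nrm (\<chi> j. P\<^sub>0 h j $ of_nat k $ 1)"
          using nrm_lower[of "\<chi> j. P\<^sub>0 h j $ of_nat k $ 1" j] by simp
        also have "\<dots> \<le> K\<^sub>0 * h ^ (2 - k)" using elim(1) that by (auto simp: numeral_eq_Suc)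
        finally show ?thesis using c by (simp add: K\<^sub>1_def field_simps)
      qed
      have "w h \<le> 1" "0 \<le> w h"
        using hpow_antimono[of h 0 p] p elim(2) by (auto simp: w_def hpow_0 hpow_nonneg)
      then have "small_trajectory h (\<sigma> j) K\<^sub>R (w h) (P\<^sub>0 h j) K\<^sub>1" for j
        using elim(2) \<sigma>[of j] K\<^sub>R K\<^sub>1 entry[of 0 j] entry[of 1 j] cov is_cov_1_1_nonneg[of "P\<^sub>0 h j"]
        by unfold_locales auto
      then show ?case using elim by blast
    qed
    have exponents: "hpow h (min 1 ((p + 1) / 2)) = max h (sqrt (h * w h))"
      "hpow h (max p ((p + 1) / 2)) = min (w h) (sqrt (h * w h))"
      "hpow h (p + 1) = h * w h" "hpow h 1 = h"
      "hpow h (max (p - 1) 0) = min (w h / h) 1" if "0 < h" "h \<le> 1" for h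
    proof -
      have "(p + 1) / 2 \<noteq> -\<infinity>" "p \<noteq> -\<infinity>" "p - 1 \<noteq> -\<infinity>"
        using p by (cases p; simp add: numeral_eq_ereal one_ereal_def)+
      then show "hpow h (min 1 ((p + 1) / 2)) = max h (sqrt (h * w h))"
        "hpow h (max p ((p + 1) / 2)) = min (w h) (sqrt (h * w h))"
        "hpow h (max (p - 1) 0) = min (w h / h) 1"
        "hpow h (p + 1) = h * w h" "hpow h 1 = h"
        using that p
        by (simp_all add: hpow_min hpow_max hpow_1 hpow_0 hpow_half[unfolded numeral_eq_ereal]
            hpow_add_1 hpow_diff_1 w_def)
    qed
    have "\<forall>j. \<exists>K>0. \<forall>h w P n. small_trajectory h (\<sigma> j) K\<^sub>R w P K\<^sub>1 \<longrightarrow> 1 \<le> n \<longrightarrow>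
        upper_orders K h (\<sigma> j) K\<^sub>R w P n"
      using ex_upper_orders[OF \<sigma> K\<^sub>R K\<^sub>1] by blast
    then obtain K where K: "\<And>j. 0 < K j" and upper: "\<And>j h w P n.
        small_trajectory h (\<sigma> j) K\<^sub>R w P K\<^sub>1 \<Longrightarrow> 1 \<le> n \<Longrightarrow> upper_orders (K j) h (\<sigma> j) K\<^sub>R w P n"
      by metis
    \<comment> \<open>The constants depend on the coordinate through \<open>\<sigma> j\<close>; as
      there are finitely many and all are positive, their sum serves every coordinate.\<close>
    define K' where "K' = sum K UNIV"
    have K': "K j \<le> K'" for j
      unfolding K'_def using K by (intro member_le_sum) (auto intro: less_imp_le)
    have K'_pos: "0 < K'" using K[of undefined] K'[of undefined] by linarith
    have "\<forall>j. \<exists>c>0. \<exists>b>0. \<forall>h w P N. small_trajectory h (\<sigma> j) K\<^sub>R w P K\<^sub>1 \<longrightarrow> h \<le> b \<longrightarrow>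
        real N * h = T \<longrightarrow> 1 \<le> N \<longrightarrow> lower_orders c h (\<sigma> j) K\<^sub>R w P N"
      using ex_lower_orders[OF \<sigma> K\<^sub>R K\<^sub>1 T] by blast
    then obtain k b where k: "\<And>j. 0 < k j" and b: "\<And>j. 0 < b j" and lower: "\<And>j h w P N.
        small_trajectory h (\<sigma> j) K\<^sub>R w P K\<^sub>1 \<Longrightarrow> h \<le> b j \<Longrightarrow> real N * h = T \<Longrightarrow> 1 \<le> N \<Longrightarrow>
        lower_orders (k j) h (\<sigma> j) K\<^sub>R w P N"
      by metis
    have lower_ev: "\<forall>\<^sub>F h in small_steps T. 0 < h \<and> h \<le> 1 \<and>
        lower_orders (k j) h (\<sigma> j) K\<^sub>R (w h) (P\<^sub>0 h j) (nat \<lfloor>T / h\<rfloor>)" for j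
      using small eventually_small_steps[OF b[of j]]
    proof eventually_elim
      case (elim h)
      \<comment> \<open>Since \<open>T / h\<close> is natural, the floor in \<open>max_steps\<close>
        is exact and \<open>N\<close> steps end at time \<open>T\<close>.\<close>
      then obtain N where N: "T / h = real N" by (auto elim: Nats_cases)
      moreover have "1 \<le> N" using N T elim by (cases N) auto
      moreover have "real N * h = T" using N elim by (simp add: field_simps)
      ultimately show ?case using elim lower[of h j] by simp
    qed
    have nrm_ge: "c * a \<le> nrm v" if "a \<le> v $ j" for a v j
    proof -
      have "c * a \<le> c * \<bar>v $ j\<bar>" using c that by (intro mult_left_mono) auto
      then show ?thesis using nrm_lower[of v j] by linarith
    qed
    let ?P = "\<lambda>h. cov_vec h \<sigma> (R h) (P\<^sub>0 h)" and ?P\<^sub>m = "\<lambda>h. pred_cov_vec h \<sigma> (R h) (P\<^sub>0 h)"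
      and ?\<beta> = "\<lambda>h. gain_vec h \<sigma> (R h) (P\<^sub>0 h)"
    have R': "R h = K\<^sub>R * w h" for h by (simp add: R w_def)
    \<comment> \<open>The factor \<open>(1 + D) * K'\<close> serves coordinatewise bounds, which
      need \<open>K'\<close>, and norms, which need \<open>D * K'\<close>.\<close>
    have upper_ev: "\<forall>\<^sub>F h in small_steps T.
        (\<forall>j. max_steps T h (\<lambda>n. ?P\<^sub>m h n 1 1 $ j) \<le> ((1 + D) * K') * hpow h (min 1 ((p + 1) / 2)))
      \<and> (\<forall>j. max_steps T h (\<lambda>n. ?P h n 1 1 $ j) \<le> ((1 + D) * K') * hpow h (max p ((p + 1) / 2)))
      \<and> max_steps T h (\<lambda>n. nrm (?P h n 0 1)) \<le> ((1 + D) * K') * hpow h (p + 1)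
      \<and> max_steps T h (\<lambda>n. nrm (?\<beta> h n 0)) \<le> ((1 + D) * K') * hpow h 1
      \<and> max_steps T h (\<lambda>n. nrm (1 - ?\<beta> h n 1)) \<le> ((1 + D) * K') * hpow h (max (p - 1) 0)"
      using small
    proof eventually_elim
      case (elim h)
      then have h: "0 < h" "h \<le> 1" "T / h \<in> \<nat>" by auto
      have w: "0 \<le> w h" by (simp add: w_def hpow_nonneg)
      have scalar: "L \<le> (1 + D) * K' * B" if "L \<le> K j * B" "0 \<le> B" for L B j
      proof -
        have "K j \<le> (1 + D) * K'"
          using K'[of j] mult_pos_pos[OF D K'_pos] unfolding distrib_right by linarith
        then show ?thesis using that mult_right_mono[of "K j" "(1 + D) * K'" B] by linarith
      qed
      have vec: "nrm v \<le> (1 + D) * K' * B" if v: "\<And>j. \<bar>v $ j\<bar> \<le> K j * B" and B: "0 \<le> B" for v B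
      proof -
        have "\<bar>v $ j\<bar> \<le> K' * B" for j
          using v[of j] B mult_right_mono[OF K'[of j], of B] by linarith
        then have "nrm v \<le> D * (K' * B)" by (rule nrm_upper)
        moreover have "0 \<le> K' * B" using K'_pos B by simp
        ultimately show ?thesis by (simp add: algebra_simps)
      qed
      have orders: "upper_orders (K j) h (\<sigma> j) K\<^sub>R (w h) (P\<^sub>0 h j) n" if "n \<in> {1..nat \<lfloor>T / h\<rfloor>}" for n j
        using upper[of h j] elim that by simp
      have "pred_cov h (\<sigma> j) (K\<^sub>R * w h) (P\<^sub>0 h j) n $ 1 $ 1 \<le>
          (1 + D) * K' * max h (sqrt (h * w h))"
        and "cov h (\<sigma> j) (K\<^sub>R * w h) (P\<^sub>0 h j) n $ 1 $ 1 \<le>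
          (1 + D) * K' * min (w h) (sqrt (h * w h))"
        if "n \<in> {1..nat \<lfloor>T / h\<rfloor>}" for n j
        using orders[OF that, of j] h w unfolding upper_orders_def
        by (auto intro!: scalar[where j = j])
      then show ?case
        unfolding max_steps_le_iff[OF T h(1,3)] exponents[OF h(1,2)]
        using orders[unfolded upper_orders_def] h w
        by (auto intro!: vec simp: cov_vec_def pred_cov_vec_def gain_vec_def R')
    qed
    \<comment> \<open>From here on each quantity gets a lower bound of exactly the claimed order,
      from which \<open>order_sharp\<close> excludes every larger exponent.\<close>
    have "\<forall>\<^sub>F h in small_steps T. k j * hpow h (min 1 ((p + 1) / 2)) \<le>
        max_steps T h (\<lambda>n. ?P\<^sub>m h n 1 1 $ j)" for j
      using lower_ev[of j]
    proof eventually_elim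
      case (elim h)
      then obtain n where n: "n \<in> {1..nat \<lfloor>T / h\<rfloor>}"
        "k j * max h (sqrt (h * w h)) \<le> pred_cov h (\<sigma> j) (K\<^sub>R * w h) (P\<^sub>0 h j) n $ 1 $ 1"
        and h: "0 < h" "h \<le> 1"
        unfolding lower_orders_def by blast
      show ?case
        unfolding exponents[OF h]
        by (rule le_max_steps[OF n(1)]) (use n(2) in \<open>simp add: pred_cov_vec_def R'\<close>)
    qed
    note sharp1 = order_sharp[OF T k _ _ this]
    have "\<forall>\<^sub>F h in small_steps T. k j * hpow h (max p ((p + 1) / 2)) \<le>
        max_steps T h (\<lambda>n. ?P h n 1 1 $ j)" for j
      using lower_ev[of j]
    proof eventually_elim
      case (elim h)
      then obtain n where n: "n \<in> {1..nat \<lfloor>T / h\<rfloor>}"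
        "k j * min (w h) (sqrt (h * w h)) \<le> cov h (\<sigma> j) (K\<^sub>R * w h) (P\<^sub>0 h j) n $ 1 $ 1"
        and h: "0 < h" "h \<le> 1"
        unfolding lower_orders_def by blast
      show ?case
        unfolding exponents[OF h]
        by (rule le_max_steps[OF n(1)]) (use n(2) in \<open>simp add: cov_vec_def R'\<close>)
    qed
    note sharp2 = order_sharp[OF T k _ _ this]
    \<comment> \<open>An arbitrary coordinate: one large coordinate already forces a large norm, by
      \<open>nrm_ge\<close>.\<close>
    let ?j = "undefined :: 'd"
    have ck: "0 < c * k ?j" using c k by simp
    have "\<forall>\<^sub>F h in small_steps T. c * k ?j * hpow h (p + 1) \<le>
        max_steps T h (\<lambda>n. nrm (?P h n 0 1))"
      using lower_ev[of ?j]
    proof eventually_elim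
      case (elim h)
      then obtain n where n: "n \<in> {1..nat \<lfloor>T / h\<rfloor>}"
        "k ?j * (h * w h) \<le> cov h (\<sigma> ?j) (K\<^sub>R * w h) (P\<^sub>0 h ?j) n $ 0 $ 1"
        and h: "0 < h" "h \<le> 1"
        unfolding lower_orders_def by blast
      show ?case
        unfolding exponents[OF h] mult.assoc
        by (rule le_max_steps[OF n(1)], rule nrm_ge[where j = ?j])
          (use n(2) in \<open>simp add: cov_vec_def R'\<close>)
    qed
    note sharp3 = order_sharp[OF T ck _ _ this]
    have "\<forall>\<^sub>F h in small_steps T. c * k ?j * hpow h 1 \<le>
        max_steps T h (\<lambda>n. nrm (?\<beta> h n 0))"
      using lower_ev[of ?j]
    proof eventually_elim
      case (elim h)
      then obtain n where n: "n \<in> {1..nat \<lfloor>T / h\<rfloor>}"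
        "k ?j * h \<le> gain (K\<^sub>R * w h) 0 (pred_cov h (\<sigma> ?j) (K\<^sub>R * w h) (P\<^sub>0 h ?j) n)"
        and h: "0 < h" "h \<le> 1"
        unfolding lower_orders_def by blast
      show ?case
        unfolding exponents[OF h] mult.assoc
        by (rule le_max_steps[OF n(1)], rule nrm_ge[where j = ?j])
          (use n(2) in \<open>simp add: gain_vec_def R'\<close>)
    qed
    note sharp4 = order_sharp[OF T ck _ _ this]
    have "\<forall>\<^sub>F h in small_steps T. c * k ?j * hpow h (max (p - 1) 0) \<le>
        max_steps T h (\<lambda>n. nrm (1 - ?\<beta> h n 1))"
      using lower_ev[of ?j]
    proof eventually_elim
      case (elim h)
      then obtain n where n: "n \<in> {1..nat \<lfloor>T / h\<rfloor>}"
        "k ?j * min (w h / h) 1 \<le> 1 - gain (K\<^sub>R * w h) 1 (pred_cov h (\<sigma> ?j) (K\<^sub>R * w h) (P\<^sub>0 h ?j) n)"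
        and h: "0 < h" "h \<le> 1"
        unfolding lower_orders_def by blast
      show ?case
        unfolding exponents[OF h] mult.assoc
        by (rule le_max_steps[OF n(1)], rule nrm_ge[where j = ?j])
          (use n(2) in \<open>simp add: gain_vec_def R'\<close>)
    qed
    note sharp5 = order_sharp[OF T ck _ _ this]
    \<comment> \<open>\<open>order_sharp\<close> takes exponents that are nonnegative and below some
      \<open>e\<close>, hence finite; for \<open>p = \<infinity>\<close> the claims whose exponent
      is infinite admit no larger \<open>e\<close> and hold vacuously.\<close>
    have nonneg: "0 \<le> min 1 ((p + 1) / 2)" "0 \<le> max p ((p + 1) / 2)" "0 \<le> p + 1"
      "0 \<le> max (p - 1) 0" "0 \<le> (1 :: ereal)"
      using p by (auto simp: le_max_iff_disj)
    have K'': "0 < (1 + D) * K'" using D K'_pos by simp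
    show ?case
      unfolding Let_def
    proof (intro conjI allI impI, goal_cases upper 1 2 3 4 5)
      case upper
      show ?case by (intro exI[of _ "(1 + D) * K'"] conjI K'' upper_ev)
    next
      case 1
      show ?case by (rule sharp1[OF nonneg(1) 1])
    next
      case 2
      show ?case by (rule sharp2[OF nonneg(2) 2])
    next
      case 3
      show ?case by (rule sharp3[OF nonneg(3) 3])
    next
      case 4
      show ?case by (rule sharp4[OF nonneg(5) 4])
    next
      case 5
      show ?case by (rule sharp5[OF nonneg(4) 5])
    qed
  qed
qed

end
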